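(* Let $1\le k\le n$ be integers, let $M\in\mathbb{R}^{2n\times 2n}$ be symmetric positive definite with symplectic eigenvalues $d_1\le d_2\le\cdots\le d_n$, let $N=\operatorname{diag}(\nu_1,\ldots,\nu_k)$ with $0<\nu_1<\nu_2<\cdots<\nu_k$, and let $\tilde N=\operatorname{diag}(N,N)$. Then $$2(d_1\nu_k+d_2\nu_{k-1}+\cdots+d_k\nu_1)=\min_{X\in\mathbb{R}^{2n\times 2k}}\operatorname{tr}(\tilde N X^TMX)\quad\text{subject to}\quad X^TJ_{2n}X=J_{2k},$$ and the minimum is attained. Moreover, the columns of any minimizer $X_*$ consist of $k$ symplectic eigenvector pairs of $M$ associated with the smallest $k$ symplectic eigenvalues of $M$ arranged in nonincreasing order, i.e., $X_*$ is a symplectic eigenvector set of $M$ and $X_*^TMX_*=\operatorname{diag}(d_k,\ldots,d_1,d_k,\ldots,d_1)$.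
   Context: $J_{2m}=\begin{bmatrix}0 & I_m\\ -I_m & 0\end{bmatrix}$. A matrix $S\in\mathbb{R}^{2n\times 2n}$ is symplectic if $S^TJ_{2n}S=J_{2n}$. By Williamson's theorem there is a symplectic $S$ with $S^TMS=\operatorname{diag}(D,D)$, $D=\operatorname{diag}(d_1,\ldots,d_n)$, $d_j>0$; the $d_j$ are the symplectic eigenvalues of $M$. Writing $S=[s_1,\ldots,s_{2n}]$, the pair $[s_j,s_{n+j}]$ is a symplectic eigenvector pair associated with $d_j$. For a $k$-tuple $\mathcal I_k=[i_1,\ldots,i_k]$ of distinct indices in $\{1,\ldots,n\}$, $S_{\mathcal I_k}=[s_{i_1},\ldots,s_{i_k},s_{n+i_1},\ldots,s_{n+i_k}]$; a matrix $X\in\mathbb{R}^{2n\times 2k}$ is a symplectic eigenvector set of $M$ (associated with $d_{i_1},\ldots,d_{i_k}$) if $X=S_{\mathcal I_k}$ for some such Williamson diagonalizer $S$ and some such $\mathcal I_k$. *)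

theory Defs
  imports "Jordan_Normal_Form.Matrix"
begin

definition mat_trace :: "real mat \<Rightarrow> real" where
  "mat_trace A = (\<Sum>i<dim_row A. A $$ (i, i))"

definition J_mat :: "nat \<Rightarrow> real mat" where
  "J_mat m = four_block_mat (0\<^sub>m m m) (1\<^sub>m m) (- 1\<^sub>m m) (0\<^sub>m m m)"

definition symplectic :: "nat \<Rightarrow> real mat \<Rightarrow> bool" where
  "symplectic n S \<longleftrightarrow> S \<in> carrier_mat (2*n) (2*n) \<and> transpose_mat S * J_mat n * S = J_mat n"

definition sym_pos_def :: "nat \<Rightarrow> real mat \<Rightarrow> bool" where
  "sym_pos_def m M \<longleftrightarrow> M \<in> carrier_mat m m \<and> transpose_mat M = M \<and>
     (\<forall>x \<in> carrier_vec m. x \<noteq> 0\<^sub>v m \<longrightarrow> x \<bullet> (M *\<^sub>v x) > 0)"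

definition diag_of :: "nat \<Rightarrow> (nat \<Rightarrow> real) \<Rightarrow> real mat" where
  "diag_of m f = mat m m (\<lambda>(i, j). if i = j then f i else 0)"

definition diag2 :: "nat \<Rightarrow> (nat \<Rightarrow> real) \<Rightarrow> real mat" where
  "diag2 m f = diag_of (2*m) (\<lambda>i. if i < m then f i else f (i - m))"

definition williamson :: "nat \<Rightarrow> real mat \<Rightarrow> real mat \<Rightarrow> (nat \<Rightarrow> real) \<Rightarrow> bool" where
  "williamson n M S d \<longleftrightarrow> symplectic n S \<and> (\<forall>j<n. d j > 0) \<and>
     transpose_mat S * M * S = diag2 n d"

definition sel_cols :: "nat \<Rightarrow> real mat \<Rightarrow> nat list \<Rightarrow> real mat" where
  "sel_cols n S I = mat (dim_row S) (2 * length I)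
     (\<lambda>(r, c). if c < length I then S $$ (r, I ! c) else S $$ (r, n + I ! (c - length I)))"

definition sympl_eigvec_set :: "nat \<Rightarrow> real mat \<Rightarrow> nat \<Rightarrow> (nat \<Rightarrow> real) \<Rightarrow> real mat \<Rightarrow> bool" where
  "sympl_eigvec_set n M k e X \<longleftrightarrow>
     (\<exists>S D I. williamson n M S D \<and> length I = k \<and> distinct I \<and> set I \<subseteq> {..<n} \<and>
        X = sel_cols n S I \<and> (\<forall>j<k. D (I ! j) = e j))"

end

theory Submission
  imports Defs Complex_Main "Jordan_Normal_Form.Determinant"
begin

text \<open>
  A Williamson diagonalizer \<open>S\<close> reduces the problem to \<open>M = diag(D, D)\<close>. Identify \<open>\<real>\<^sup>2\<^sup>n\<close> with
  \<open>\<complex>\<^sup>n\<close> and split each symplectic pair \<open>(a, b)\<close> into \<open>u = (a - ib)/2\<close> and the conjugate \<open>v\<close> of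
  \<open>(a + ib)/2\<close>. The symplectic constraint makes the Gram matrices satisfy \<open>U\<^sup>*U = I + V\<^sup>*V\<close>, and the
  objective is a weighted sum of \<open>\<langle>u, Du\<rangle> + \<langle>v, Dv\<rangle>\<close>. Since \<open>U\<^sup>*U \<ge> I\<close>, the leverage scores of \<open>U\<close>
  bound every partial sum of \<open>\<langle>u, Du\<rangle>\<close> below by the sum of the smallest \<open>d\<^sub>i\<close>, and summation by parts
  inserts the weights. Equality makes all these partial bounds tight, so \<open>v = 0\<close> and the \<open>u\<close> are
  orthonormal eigenvectors of \<open>D\<close>; an orthonormal eigenbasis extending them yields a diagonalizer of
  \<open>M\<close> that contains the given columns.
\<close>

section \<open>Trace bounds for frames\<close>

text \<open>A singular square matrix has a nonzero kernel vector, which injectivity excludes; so the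
  determinant is nonzero and the matrix is a unit. This is used to invert Gram matrices.\<close>

lemma injective_imp_right_inverse:
  fixes G :: "nat \<Rightarrow> nat \<Rightarrow> 'a :: field"
  assumes inj: "\<And>x. (\<And>a. a < m \<Longrightarrow> (\<Sum>b<m. G a b * x b) = 0) \<Longrightarrow> (\<And>b. b < m \<Longrightarrow> x b = 0)"
  obtains Z where "\<And>a b. a < m \<Longrightarrow> b < m \<Longrightarrow> (\<Sum>c<m. G a c * Z c b) = (if a = b then 1 else 0)"
proof -
  define A where "A = mat m m (\<lambda>(a, b). G a b)"
  have A: "A \<in> carrier_mat m m" by (simp add: A_def)
  have "det A \<noteq> 0"
  proof
    assume "det A = 0"
    then obtain v where v: "v \<in> carrier_vec m" "v \<noteq> 0\<^sub>v m" "A *\<^sub>v v = 0\<^sub>v m"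
      using det_0_iff_vec_prod_zero_field[OF A] by auto
    have "(\<Sum>b<m. G a b * v $ b) = 0" if "a < m" for a
    proof -
      have "(A *\<^sub>v v) $ a = (\<Sum>b<m. G a b * v $ b)"
        using that v(1) by (simp add: A_def scalar_prod_def atLeast0LessThan)
      then show ?thesis using v(3) that by simp
    qed
    then have "v $ b = 0" if "b < m" for b
      using inj[of "\<lambda>b. v $ b"] that by blast
    then have "v = 0\<^sub>v m" using v(1) by (intro eq_vecI) auto
    with v(2) show False by simp
  qed
  then obtain B where B: "B \<in> carrier_mat m m" "A * B = 1\<^sub>m m"
    using det_non_zero_imp_unit[OF A, of "()"] by (auto simp: Units_def ring_mat_def)
  show thesis
  proof
    fix a b assume ab: "a < m" "b < m"
    have "(A * B) $$ (a, b) = (\<Sum>c<m. G a c * B $$ (c, b))"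
      using ab B(1) A by (simp add: A_def scalar_prod_def atLeast0LessThan)
    then show "(\<Sum>c<m. G a c * B $$ (c, b)) = (if a = b then 1 else 0)"
      using B(2) ab by simp
  qed
qed

lemma of_real_cmod_square: "complex_of_real ((cmod z)\<^sup>2) = cnj z * z"
  by (simp only: complex_norm_square mult.commute)

text \<open>The witness \<open>P i\<close> is the leverage score of row \<open>i\<close>, the \<open>i\<close>-th diagonal entry of the
  orthogonal projection \<open>U (U\<^sup>*U)\<^sup>-\<^sup>1 U\<^sup>*\<close>.\<close>

lemma leverage_scores:
  fixes u :: "nat \<Rightarrow> nat \<Rightarrow> complex"
  assumes frame: "\<And>x. (\<Sum>j<m. (cmod (x j))\<^sup>2) \<le> (\<Sum>i<n. (cmod (\<Sum>j<m. u i j * x j))\<^sup>2)"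
  obtains P :: "nat \<Rightarrow> real"
  where "\<And>i. i < n \<Longrightarrow> 0 \<le> P i" "\<And>i. i < n \<Longrightarrow> P i \<le> 1"
    "\<And>i. i < n \<Longrightarrow> P i \<le> (\<Sum>j<m. (cmod (u i j))\<^sup>2)" "(\<Sum>i<n. P i) = real m"
proof -
  define G where "G a b = (\<Sum>i<n. cnj (u i a) * u i b)" for a b
  have Gx: "(\<Sum>b<m. G a b * x b) = (\<Sum>i<n. cnj (u i a) * (\<Sum>b<m. u i b * x b))" for a x
    unfolding G_def sum_distrib_right sum_distrib_left
    by (subst sum.swap) (simp add: mult.assoc)
  \<comment> \<open>\<open>Z\<close> inverts the Gram matrix: if Gx = 0, then the quadratic form of
    \<open>G\<close> at x, which is the squared norm of Ux, vanishes, and the frame bound forces x =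
    0.\<close>
  obtain Z where Z: "\<And>a b. a < m \<Longrightarrow> b < m \<Longrightarrow> (\<Sum>c<m. G a c * Z c b) = (if a = b then 1 else 0)"
  proof (rule injective_imp_right_inverse[of m G])
    fix x b
    assume 0: "\<And>a. a < m \<Longrightarrow> (\<Sum>b<m. G a b * x b) = 0" and b: "b < m"
    have "complex_of_real (\<Sum>i<n. (cmod (\<Sum>j<m. u i j * x j))\<^sup>2)
        = (\<Sum>i<n. cnj (\<Sum>j<m. u i j * x j) * (\<Sum>j<m. u i j * x j))"
      by (simp only: of_real_sum of_real_cmod_square)
    also have "\<dots> = (\<Sum>i<n. \<Sum>a<m. cnj (x a) * (cnj (u i a) * (\<Sum>j<m. u i j * x j)))"
      by (simp only: cnj_sum complex_cnj_mult sum_distrib_right mult.assoc mult.left_commute)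
    also have "\<dots> = (\<Sum>a<m. cnj (x a) * (\<Sum>b<m. G a b * x b))"
      unfolding Gx by (subst sum.swap) (simp add: sum_distrib_left)
    also have "\<dots> = 0" using 0 by simp
    finally have "(\<Sum>i<n. (cmod (\<Sum>j<m. u i j * x j))\<^sup>2) = 0"
      by (simp only: of_real_eq_0_iff)
    then have "(\<Sum>j<m. (cmod (x j))\<^sup>2) \<le> 0" using frame[of x] by simp
    then have "(\<Sum>j<m. (cmod (x j))\<^sup>2) = 0" by (intro antisym sum_nonneg) auto
    then show "x b = 0" using b by (subst (asm) sum_nonneg_eq_0_iff) auto
  qed blast
  define z where "z i b = (\<Sum>c<m. Z b c * cnj (u i c))" for i b
  define h where "h i i' = (\<Sum>b<m. u i' b * z i b)" for i i'
  \<comment> \<open>\<open>h i\<close> and the standard basis vector e_i have the same inner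
    products with the columns of U, so their difference is orthogonal to the range.\<close>
  have uh: "(\<Sum>i'<n. cnj (u i' a) * h i i') = cnj (u i a)" if "a < m" for a i
  proof -
    have "(\<Sum>i'<n. cnj (u i' a) * h i i') = (\<Sum>b<m. G a b * z i b)"
      by (simp add: Gx h_def)
    also have "\<dots> = (\<Sum>c<m. (\<Sum>b<m. G a b * Z b c) * cnj (u i c))"
      unfolding z_def sum_distrib_left sum_distrib_right
      by (subst sum.swap) (simp add: mult.assoc)
    also have "\<dots> = (\<Sum>c<m. if a = c then cnj (u i c) else 0)"
      using Z that by (intro sum.cong) auto
    also have "\<dots> = cnj (u i a)" using that by simp
    finally show ?thesis .
  qed
  \<comment> \<open>Since \<open>h i\<close> lies in the range of U, its squared norm equals its
    inner product with e_i, a diagonal entry of the projection. That entry is therefore real and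
    nonnegative.\<close>
  have hh: "cnj (h i i) = of_real (\<Sum>i'<n. (cmod (h i i'))\<^sup>2)" for i
  proof -
    have "complex_of_real (\<Sum>i'<n. (cmod (h i i'))\<^sup>2) = (\<Sum>i'<n. cnj (\<Sum>b<m. u i' b * z i b) * h i i')"
      by (simp only: of_real_sum of_real_cmod_square flip: h_def)
    also have "\<dots> = (\<Sum>i'<n. \<Sum>b<m. cnj (z i b) * (cnj (u i' b) * h i i'))"
      by (simp only: cnj_sum complex_cnj_mult sum_distrib_right mult.assoc mult.left_commute)
    also have "\<dots> = (\<Sum>b<m. cnj (z i b) * (\<Sum>i'<n. cnj (u i' b) * h i i'))"
      by (subst sum.swap) (simp add: sum_distrib_left)
    also have "\<dots> = (\<Sum>b<m. cnj (z i b) * cnj (u i b))"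
      by (intro sum.cong) (auto simp: uh)
    also have "\<dots> = cnj (h i i)"
      by (simp add: h_def mult.commute)
    finally show ?thesis by simp
  qed
  define P where "P i = (\<Sum>i'<n. (cmod (h i i'))\<^sup>2)" for i
  have hP: "h i i = of_real (P i)" for i
    using arg_cong[OF hh[of i], of cnj] by (simp only: P_def complex_cnj_cnj complex_cnj_complex_of_real)
  have P0: "0 \<le> P i" for i by (simp add: P_def sum_nonneg)
  show thesis
  proof
    show "0 \<le> P i" for i by (rule P0)
    \<comment> \<open>\<open>P i\<close> is the squared norm of a column as well as one of its
      entries, so its square is at most \<open>P i\<close>.\<close>
    show "P i \<le> 1" if "i < n" for i
    proof -
      have "(cmod (h i i))\<^sup>2 \<le> P i"
        unfolding P_def using that by (intro member_le_sum) auto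
      then have "P i * P i \<le> P i" by (simp add: hP power2_eq_square)
      moreover have "P i < P i * P i" if "1 < P i"
        using mult_strict_left_mono[of 1 "P i" "P i"] that by simp
      ultimately show ?thesis by (metis not_le)
    qed
    \<comment> \<open>The frame bound at \<open>z i\<close> bounds the squared norm of
      \<open>z i\<close> by \<open>P i\<close>. The AM-GM inequality bounds \<open>P i\<close> by
      half the sum of the squared norms of row i and \<open>z i\<close>; absorbing half of
      \<open>P i\<close> leaves the claim.\<close>
    show "P i \<le> (\<Sum>j<m. (cmod (u i j))\<^sup>2)" for i
    proof -
      have "(\<Sum>b<m. (cmod (z i b))\<^sup>2) \<le> P i"
        using frame[of "z i"] by (simp add: P_def h_def)
      moreover have "P i \<le> (\<Sum>b<m. ((cmod (u i b))\<^sup>2 + (cmod (z i b))\<^sup>2) / 2)"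
      proof -
        have "P i = cmod (h i i)" using P0 by (simp add: hP)
        also have "\<dots> \<le> (\<Sum>b<m. cmod (u i b) * cmod (z i b))"
          unfolding h_def by (rule order_trans[OF norm_sum]) (simp add: norm_mult)
        also have "\<dots> \<le> (\<Sum>b<m. ((cmod (u i b))\<^sup>2 + (cmod (z i b))\<^sup>2) / 2)"
        proof (rule sum_mono)
          fix b
          show "cmod (u i b) * cmod (z i b) \<le> ((cmod (u i b))\<^sup>2 + (cmod (z i b))\<^sup>2) / 2"
            using sum_squares_bound[of "cmod (u i b)" "cmod (z i b)"] by simp
        qed
        finally show ?thesis .
      qed
      ultimately show ?thesis
        by (simp add: sum.distrib flip: sum_divide_distrib)
    qed
    \<comment> \<open>Cyclicity of the trace: the trace of the projection is that of GZ, the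
      identity of size m.\<close>
    have "complex_of_real (\<Sum>i<n. P i) = (\<Sum>i<n. \<Sum>b<m. \<Sum>c<m. u i b * (Z b c * cnj (u i c)))"
      by (simp flip: hP add: h_def z_def sum_distrib_left)
    also have "\<dots> = (\<Sum>b<m. \<Sum>i<n. \<Sum>c<m. u i b * (Z b c * cnj (u i c)))"
      by (rule sum.swap)
    also have "\<dots> = (\<Sum>b<m. \<Sum>c<m. \<Sum>i<n. u i b * (Z b c * cnj (u i c)))"
      by (intro sum.cong refl sum.swap)
    also have "\<dots> = (\<Sum>b<m. \<Sum>c<m. G c b * Z b c)"
      by (simp add: G_def sum_distrib_left mult_ac)
    also have "\<dots> = (\<Sum>c<m. \<Sum>b<m. G c b * Z b c)" by (rule sum.swap)
    also have "\<dots> = of_nat m" using Z by simp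
    finally show "(\<Sum>i<n. P i) = real m"
      by (metis of_real_eq_iff of_real_of_nat_eq)
  qed
qed

text \<open>The bathtub principle: moving weight from indices beyond l to the first l, where there
  is still room, cannot increase the sum. In the equality case no weight sits strictly above the
  threshold \<open>d (l - 1)\<close>.\<close>

lemma weighted_sum_ge_initial_sum:
  fixes d P :: "nat \<Rightarrow> real"
  assumes l: "0 < l" "l \<le> n"
    and d: "\<And>i j. i \<le> j \<Longrightarrow> j < n \<Longrightarrow> d i \<le> d j"
    and P: "\<And>i. i < n \<Longrightarrow> 0 \<le> P i" "\<And>i. i < n \<Longrightarrow> P i \<le> 1" "(\<Sum>i<n. P i) = real l"
  shows "(\<Sum>i<l. d i) \<le> (\<Sum>i<n. d i * P i)"
    and "(\<Sum>i<n. d i * P i) = (\<Sum>i<l. d i) \<Longrightarrow> i < n \<Longrightarrow> d (l - 1) < d i \<Longrightarrow> P i = 0"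
proof -
  \<comment> \<open>The two factors have equal sign on either side of i = l, so each term is
    nonnegative. Subtracting the threshold leaves the total unchanged because both weight vectors
    sum to l.\<close>
  define f where "f i = (d i - d (l - 1)) * (P i - (if i < l then 1 else 0))" for i
  have restr: "(\<Sum>i<n. g i * (if i < l then 1 else 0)) = (\<Sum>i<l. g i)" for g :: "nat \<Rightarrow> real"
  proof -
    have "(\<Sum>i<n. g i * (if i < l then 1 else 0)) = (\<Sum>i\<in>{i \<in> {..<n}. i < l}. g i)"
      by (subst sum.inter_filter) (auto intro!: sum.cong)
    also have "{i \<in> {..<n}. i < l} = {..<l}" using l by auto
    finally show ?thesis .
  qed
  have "(\<Sum>i<n. f i) = (\<Sum>i<n. d i * P i) - (\<Sum>i<n. d i * (if i < l then 1 else 0))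
      - d (l - 1) * ((\<Sum>i<n. P i) - (\<Sum>i<n. 1 * (if i < l then 1 else 0)))"
    by (simp add: f_def algebra_simps sum.distrib sum_subtractf sum_distrib_left sum_distrib_right)
  also have "\<dots> = (\<Sum>i<n. d i * P i) - (\<Sum>i<l. d i)"
    unfolding restr P(3) by simp
  finally have sum_f: "(\<Sum>i<n. f i) = (\<Sum>i<n. d i * P i) - (\<Sum>i<l. d i)" .
  have f0: "0 \<le> f i" if "i < n" for i
  proof (cases "i < l")
    case True
    then have "d i \<le> d (l - 1)" using d[of i "l - 1"] l by auto
    with True P(2)[OF that] show ?thesis by (simp add: f_def mult_nonpos_nonpos)
  next
    case False
    then have "d (l - 1) \<le> d i" using d[of "l - 1" i] that by auto
    with False P(1)[OF that] show ?thesis by (simp add: f_def)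
  qed
  show "(\<Sum>i<l. d i) \<le> (\<Sum>i<n. d i * P i)"
    using sum_f sum_nonneg[of "{..<n}" f] f0 by auto
  show "P i = 0" if eq: "(\<Sum>i<n. d i * P i) = (\<Sum>i<l. d i)" and i: "i < n" "d (l - 1) < d i"
  proof -
    have "f i = 0"
      using sum_f eq f0 i(1) sum_nonneg_eq_0_iff[of "{..<n}" f] by auto
    moreover have "\<not> i < l" using d[of i "l - 1"] l i by force
    ultimately show ?thesis using i by (simp add: f_def)
  qed
qed

text \<open>Leverage scores lie below the squared row norms, and positivity of d carries this over
  to the weighted sums. Equality makes both estimates tight: above the threshold the score is zero
  and equals the row norm, so the row vanishes.\<close>

lemma frame_trace_bound:
  fixes u :: "nat \<Rightarrow> nat \<Rightarrow> complex" and d :: "nat \<Rightarrow> real"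
  assumes l: "0 < l" "l \<le> n"
    and d: "\<And>i j. i \<le> j \<Longrightarrow> j < n \<Longrightarrow> d i \<le> d j" "\<And>i. i < n \<Longrightarrow> 0 < d i"
    and frame: "\<And>x. (\<Sum>j<l. (cmod (x j))\<^sup>2) \<le> (\<Sum>i<n. (cmod (\<Sum>j<l. u i j * x j))\<^sup>2)"
  shows "(\<Sum>i<l. d i) \<le> (\<Sum>j<l. \<Sum>i<n. d i * (cmod (u i j))\<^sup>2)"
    and "(\<Sum>j<l. \<Sum>i<n. d i * (cmod (u i j))\<^sup>2) = (\<Sum>i<l. d i) \<Longrightarrow>
      i < n \<Longrightarrow> j < l \<Longrightarrow> d (l - 1) < d i \<Longrightarrow> u i j = 0"
proof -
  obtain P where P: "\<And>i. i < n \<Longrightarrow> 0 \<le> P i" "\<And>i. i < n \<Longrightarrow> P i \<le> 1"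
    and Pq: "\<And>i. i < n \<Longrightarrow> P i \<le> (\<Sum>j<l. (cmod (u i j))\<^sup>2)" and Ps: "(\<Sum>i<n. P i) = real l"
    using leverage_scores[OF frame] by blast
  define q where "q i = (\<Sum>j<l. (cmod (u i j))\<^sup>2)" for i
  have swap: "(\<Sum>j<l. \<Sum>i<n. d i * (cmod (u i j))\<^sup>2) = (\<Sum>i<n. d i * q i)"
    unfolding q_def sum_distrib_left by (rule sum.swap)
  have le_term: "d i * P i \<le> d i * q i" if "i < n" for i
    using Pq[OF that] d(2)[OF that] by (simp add: q_def)
  have le: "(\<Sum>i<n. d i * P i) \<le> (\<Sum>i<n. d i * q i)"
    using le_term by (intro sum_mono) auto
  note W = weighted_sum_ge_initial_sum[of l n d P, OF l d(1) P Ps]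
  show "(\<Sum>i<l. d i) \<le> (\<Sum>j<l. \<Sum>i<n. d i * (cmod (u i j))\<^sup>2)"
    using W(1) le swap by simp
  assume eq: "(\<Sum>j<l. \<Sum>i<n. d i * (cmod (u i j))\<^sup>2) = (\<Sum>i<l. d i)"
    and i: "i < n" and j: "j < l" and di: "d (l - 1) < d i"
  have eqP: "(\<Sum>i<n. d i * P i) = (\<Sum>i<l. d i)" using W(1) le swap eq by simp
  then have "P i = 0" using W(2) i di by blast
  moreover have "(\<Sum>i<n. d i * q i - d i * P i) = 0"
    using eqP swap eq by (simp add: sum_subtractf)
  then have "d i * q i - d i * P i = 0"
    using le_term i by (subst (asm) sum_nonneg_eq_0_iff) auto
  ultimately have "q i = 0" using d(2)[OF i] by simp
  then show "u i j = 0"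
    using j unfolding q_def by (subst (asm) sum_nonneg_eq_0_iff) auto
qed

section \<open>Summation by parts with decreasing weights\<close>

lemma sum_by_parts_partial_sums:
  fixes \<mu> x :: "nat \<Rightarrow> real"
  shows "(\<Sum>j<Suc m. \<mu> j * x j)
    = (\<Sum>l<m. (\<mu> l - \<mu> (Suc l)) * (\<Sum>j<Suc l. x j)) + \<mu> m * (\<Sum>j<Suc m. x j)"
  by (induction m) (simp_all add: algebra_simps)

text \<open>After summation by parts, the partial sums carry as coefficients the gaps between
  consecutive weights and the last weight, all positive. If the total is zero, every partial sum is
  zero, hence so is every difference of consecutive ones.\<close>

lemma decreasing_weights_sum_nonneg:
  fixes \<mu> x :: "nat \<Rightarrow> real"
  assumes \<mu>: "\<And>j. j < k \<Longrightarrow> 0 < \<mu> j" "\<And>j. Suc j < k \<Longrightarrow> \<mu> (Suc j) < \<mu> j"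
    and S: "\<And>l. 0 < l \<Longrightarrow> l \<le> k \<Longrightarrow> 0 \<le> (\<Sum>j<l. x j)"
  shows "0 \<le> (\<Sum>j<k. \<mu> j * x j)"
    and "(\<Sum>j<k. \<mu> j * x j) = 0 \<Longrightarrow> j < k \<Longrightarrow> x j = 0"
proof -
  have *: "0 \<le> (\<Sum>j<k. \<mu> j * x j) \<and> ((\<Sum>j<k. \<mu> j * x j) = 0 \<longrightarrow> (\<forall>j<k. x j = 0))"
  proof (cases k)
    case (Suc m)
    let ?S = "\<lambda>l. \<Sum>j<l. x j"
    have t: "0 \<le> (\<mu> l - \<mu> (Suc l)) * ?S (Suc l)" if "l < m" for l
      using \<mu>(2)[of l] S[of "Suc l"] that Suc by (intro mult_nonneg_nonneg) auto
    have t': "0 \<le> \<mu> m * ?S (Suc m)"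
      using \<mu>(1)[of m] S[of "Suc m"] Suc by (intro mult_nonneg_nonneg) auto
    have nn: "0 \<le> (\<Sum>l<m. (\<mu> l - \<mu> (Suc l)) * ?S (Suc l))" using t by (intro sum_nonneg) auto
    have "x j = 0" if 0: "(\<Sum>j<k. \<mu> j * x j) = 0" and j: "j < k" for j
    proof -
      have z1: "(\<Sum>l<m. (\<mu> l - \<mu> (Suc l)) * ?S (Suc l)) = 0" and z2: "\<mu> m * ?S (Suc m) = 0"
        using 0 nn t' sum_by_parts_partial_sums[of \<mu> x m] unfolding Suc by linarith+
      have S0: "?S l = 0" if "l \<le> k" for l
      proof (cases l)
        case (Suc l')
        show ?thesis
        proof (cases "l' < m")
          case True
          then have "(\<mu> l' - \<mu> (Suc l')) * ?S (Suc l') = 0"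
            using z1 t by (subst (asm) sum_nonneg_eq_0_iff) auto
          moreover have "\<mu> (Suc l') < \<mu> l'" using \<mu>(2) True \<open>k = Suc m\<close> by simp
          ultimately show ?thesis using Suc by simp
        next
          case False
          then have "l' = m" using that Suc \<open>k = Suc m\<close> by simp
          with z2 \<mu>(1)[of m] Suc \<open>k = Suc m\<close> show ?thesis by simp
        qed
      qed simp
      show ?thesis using S0[of j] S0[of "Suc j"] j by simp
    qed
    moreover have "0 \<le> (\<Sum>j<k. \<mu> j * x j)"
      using nn t' sum_by_parts_partial_sums[of \<mu> x m] unfolding Suc by linarith
    ultimately show ?thesis by blast
  qed simp
  show "0 \<le> (\<Sum>j<k. \<mu> j * x j)" using * by blast
  show "(\<Sum>j<k. \<mu> j * x j) = 0 \<Longrightarrow> j < k \<Longrightarrow> x j = 0" using * by blast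
qed

section \<open>Orthonormal eigenbases\<close>

definition orthonormal_columns :: "nat \<Rightarrow> nat \<Rightarrow> (nat \<Rightarrow> nat \<Rightarrow> complex) \<Rightarrow> bool" where
  "orthonormal_columns n m u \<longleftrightarrow>
     (\<forall>a<m. \<forall>b<m. (\<Sum>i<n. cnj (u i a) * u i b) = (if a = b then 1 else 0))"

text \<open>A support condition expressing that column j lies in the eigenspace of the diagonal
  matrix of d for the value \<open>e j\<close>.\<close>

definition eigen_columns ::
  "nat \<Rightarrow> (nat \<Rightarrow> real) \<Rightarrow> nat \<Rightarrow> (nat \<Rightarrow> real) \<Rightarrow> (nat \<Rightarrow> nat \<Rightarrow> complex) \<Rightarrow> bool" where
  "eigen_columns n d m e u \<longleftrightarrow> (\<forall>i<n. \<forall>j<m. u i j \<noteq> 0 \<longrightarrow> d i = e j)"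

lemma sum_mult_indicator:
  fixes g :: "nat \<Rightarrow> complex"
  assumes "i < n"
  shows "(\<Sum>i'<n. g i' * (if i' = i then 1 else 0)) = g i"
proof -
  have "(\<Sum>i'<n. g i' * (if i' = i then 1 else 0)) = (\<Sum>i'<n. if i' = i then g i' else 0)"
    by (intro sum.cong) auto
  then show ?thesis using assms by simp
qed

lemma orthonormal_columns_norm:
  assumes "orthonormal_columns n m u" "j < m"
  shows "(\<Sum>i<n. (cmod (u i j))\<^sup>2) = 1"
proof -
  have "complex_of_real (\<Sum>i<n. (cmod (u i j))\<^sup>2) = 1"
    using assms by (simp only: of_real_sum of_real_cmod_square orthonormal_columns_def) simp
  then show ?thesis by (simp only: of_real_eq_1_iff)
qed

text \<open>The new column is the residual \<open>\<rho>\<close> of a standard basis vector \<open>e\<^sub>i\<close> after projection onto the given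
  columns. A column meeting coordinate \<open>i\<close> belongs to the eigenvalue \<open>d i\<close>, so \<open>\<rho>\<close> stays in that eigenspace.\<close>

lemma extend_orthonormal_eigen_columns_step:
  assumes u: "orthonormal_columns n m u" "eigen_columns n d m e u" and m: "m < n"
  obtains w f where "orthonormal_columns n (Suc m) w" "eigen_columns n d (Suc m) f w"
    "\<And>i j. j < m \<Longrightarrow> w i j = u i j" "\<And>j. j < m \<Longrightarrow> f j = e j"
proof -
  \<comment> \<open>\<open>s i\<close> will be the squared norm of the residual of e_i. These
    numbers add up to n - m > 0, so some residual is nonzero.\<close>
  define s where "s i = 1 - (\<Sum>j<m. (cmod (u i j))\<^sup>2)" for i
  have "(\<Sum>i<n. s i) = real n - (\<Sum>j<m. \<Sum>i<n. (cmod (u i j))\<^sup>2)"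
    unfolding s_def sum_subtractf by (subst sum.swap) simp
  also have "\<dots> = real n - real m" using orthonormal_columns_norm[OF u(1)] by simp
  finally have "0 < (\<Sum>i<n. s i)" using m by simp
  then obtain i where i: "i < n" "0 < s i"
    using sum_nonpos[of "{..<n}" s] by force
  define \<rho> where "\<rho> i' = (if i' = i then 1 else 0) - (\<Sum>j<m. u i' j * cnj (u i j))" for i'
  have orth: "(\<Sum>i'<n. cnj (u i' a) * \<rho> i') = 0" if a: "a < m" for a
  proof -
    have "(\<Sum>i'<n. cnj (u i' a) * \<rho> i') = (\<Sum>i'<n. cnj (u i' a) * (if i' = i then 1 else 0))
        - (\<Sum>i'<n. \<Sum>j<m. cnj (u i' a) * u i' j * cnj (u i j))"
      by (simp only: \<rho>_def right_diff_distrib sum_subtractf sum_distrib_left mult.assoc)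
    also have "(\<Sum>i'<n. \<Sum>j<m. cnj (u i' a) * u i' j * cnj (u i j))
        = (\<Sum>j<m. (\<Sum>i'<n. cnj (u i' a) * u i' j) * cnj (u i j))"
      unfolding sum_distrib_right by (rule sum.swap)
    also have "\<dots> = (\<Sum>j<m. if a = j then cnj (u i j) else 0)"
      using u(1) a by (intro sum.cong) (auto simp: orthonormal_columns_def)
    also have "\<dots> = cnj (u i a)" using a by simp
    finally show ?thesis using sum_mult_indicator[OF i(1)] by simp
  qed
  have orth': "(\<Sum>i'<n. cnj (\<rho> i') * u i' a) = 0" if a: "a < m" for a
    using arg_cong[OF orth[OF a], of cnj] by (simp add: mult.commute)
  \<comment> \<open>The residual is orthogonal to all given columns, so its squared norm reduces to
    its inner product with e_i.\<close>
  have norm: "(\<Sum>i'<n. cnj (\<rho> i') * \<rho> i') = of_real (s i)"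
  proof -
    have "(\<Sum>i'<n. cnj (\<rho> i') * \<rho> i') = (\<Sum>i'<n. cnj (\<rho> i') * (if i' = i then 1 else 0))
        - (\<Sum>i'<n. \<Sum>j<m. cnj (\<rho> i') * u i' j * cnj (u i j))"
      by (subst (2) \<rho>_def) (simp only: right_diff_distrib sum_subtractf sum_distrib_left mult.assoc)
    also have "(\<Sum>i'<n. \<Sum>j<m. cnj (\<rho> i') * u i' j * cnj (u i j))
        = (\<Sum>j<m. (\<Sum>i'<n. cnj (\<rho> i') * u i' j) * cnj (u i j))"
      unfolding sum_distrib_right by (rule sum.swap)
    also have "\<dots> = 0" using orth' by simp
    also have "(\<Sum>i'<n. cnj (\<rho> i') * (if i' = i then 1 else 0)) = cnj (\<rho> i)"
      by (rule sum_mult_indicator[OF i(1)])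
    also have "cnj (\<rho> i) = 1 - (\<Sum>j<m. cnj (u i j) * u i j)"
      by (simp add: \<rho>_def)
    also have "\<dots> = of_real (s i)"
      by (simp only: s_def of_real_diff of_real_sum of_real_cmod_square of_real_1)
    finally show ?thesis by simp
  qed
  define c where "c = complex_of_real (1 / sqrt (s i))"
  have c: "cnj c = c" by (simp add: c_def)
  have cc: "c * c * of_real (s i) = 1"
  proof -
    have "c * c * of_real (s i) = of_real (1 / sqrt (s i) * (1 / sqrt (s i)) * s i)"
      by (simp only: c_def of_real_mult)
    also have "1 / sqrt (s i) * (1 / sqrt (s i)) * s i = 1" using i(2) by simp
    finally show ?thesis by simp
  qed
  define w where "w i' j = (if j < m then u i' j else c * \<rho> i')" for i' j
  define f where "f j = (if j < m then e j else d i)" for j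
  show thesis
  proof
    show "orthonormal_columns n (Suc m) w"
      unfolding orthonormal_columns_def
    proof (intro allI impI)
      fix a b assume ab: "a < Suc m" "b < Suc m"
      consider "a < m" "b < m" | "a < m" "b = m" | "a = m" "b < m" | "a = m" "b = m"
        using ab by linarith
      then show "(\<Sum>i<n. cnj (w i a) * w i b) = (if a = b then 1 else 0)"
      proof cases
        case 1
        then show ?thesis using u(1) by (simp add: w_def orthonormal_columns_def)
      next
        case 2
        then have "(\<Sum>i<n. cnj (w i a) * w i b) = c * (\<Sum>i<n. cnj (u i a) * \<rho> i)"
          by (simp add: w_def sum_distrib_left mult.left_commute)
        then show ?thesis using orth 2 by simp
      next
        case 3
        then have "(\<Sum>i<n. cnj (w i a) * w i b) = c * (\<Sum>i<n. cnj (\<rho> i) * u i b)"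
          by (simp add: w_def sum_distrib_left mult.assoc c)
        then show ?thesis using orth' 3 by simp
      next
        case 4
        then have "(\<Sum>i<n. cnj (w i a) * w i b) = c * c * (\<Sum>i<n. cnj (\<rho> i) * \<rho> i)"
          by (simp add: w_def sum_distrib_left mult_ac c)
        then show ?thesis using norm cc 4 by simp
      qed
    qed
    have \<rho>_eigen: "d i' = d i" if "i' < n" "\<rho> i' \<noteq> 0" for i'
    proof (cases "i' = i")
      case False
      with that have "(\<Sum>j<m. u i' j * cnj (u i j)) \<noteq> 0" by (simp add: \<rho>_def)
      then obtain j where j: "j \<in> {..<m}" "u i' j * cnj (u i j) \<noteq> 0"
        by (rule sum.not_neutral_contains_not_neutral)
      then have "d i' = e j" "d i = e j"
        using u(2) that(1) i(1) by (simp_all add: eigen_columns_def)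
      then show ?thesis by simp
    qed simp
    show "eigen_columns n d (Suc m) f w"
      unfolding eigen_columns_def
    proof (intro allI impI)
      fix i' j assume *: "i' < n" "j < Suc m" "w i' j \<noteq> 0"
      show "d i' = f j"
      proof (cases "j < m")
        case True
        with *(3) have "u i' j \<noteq> 0" by (simp add: w_def)
        with *(1) True u(2) have "d i' = e j" unfolding eigen_columns_def by blast
        with True show ?thesis by (simp add: f_def)
      next
        case False
        with *(3) have "\<rho> i' \<noteq> 0" by (auto simp: w_def)
        then have "d i' = d i" by (rule \<rho>_eigen[OF *(1)])
        with False show ?thesis by (simp add: f_def)
      qed
    qed
  qed (simp_all add: w_def f_def)
qed

text \<open>Columns are appended one at a time, as an induction downwards from m = n. The given ones
  keep their positions, so they can later be selected by index.\<close>

lemma extend_orthonormal_eigen_columns: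
  assumes "orthonormal_columns n m u" "eigen_columns n d m e u" "m \<le> n"
  shows "\<exists>w f. orthonormal_columns n n w \<and> eigen_columns n d n f w \<and>
    (\<forall>i. \<forall>j<m. w i j = u i j) \<and> (\<forall>j<m. f j = e j)"
  using assms(3,1,2)
proof (induction m arbitrary: u e rule: inc_induct)
  case base
  then show ?case by blast
next
  case (step m)
  obtain w f where w: "orthonormal_columns n (Suc m) w" "eigen_columns n d (Suc m) f w"
    "\<And>i j. j < m \<Longrightarrow> w i j = u i j" "\<And>j. j < m \<Longrightarrow> f j = e j"
    by (rule extend_orthonormal_eigen_columns_step[OF step.prems step.hyps(2)]) blast
  from step.IH[OF w(1,2)] obtain w' f' where w':
    "orthonormal_columns n n w'" "eigen_columns n d n f' w'"
    "\<forall>i. \<forall>j<Suc m. w' i j = w i j" "\<forall>j<Suc m. f' j = f j" by blast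
  then show ?case using w(3,4) by (intro exI[of _ w'] exI[of _ f']) simp
qed

section \<open>From Gram matrices to frame bounds\<close>

lemma gram_quadratic_form:
  fixes u :: "nat \<Rightarrow> nat \<Rightarrow> complex"
  shows "complex_of_real (\<Sum>i<n. (cmod (\<Sum>j<m. u i j * x j))\<^sup>2)
    = (\<Sum>a<m. \<Sum>b<m. cnj (x a) * x b * (\<Sum>i<n. cnj (u i a) * u i b))"
proof -
  have "complex_of_real (\<Sum>i<n. (cmod (\<Sum>j<m. u i j * x j))\<^sup>2)
      = (\<Sum>i<n. \<Sum>a<m. \<Sum>b<m. cnj (x a) * x b * (cnj (u i a) * u i b))"
    by (simp only: of_real_sum of_real_cmod_square cnj_sum complex_cnj_mult sum_product)
      (simp only: mult_ac)
  also have "\<dots> = (\<Sum>a<m. \<Sum>i<n. \<Sum>b<m. cnj (x a) * x b * (cnj (u i a) * u i b))"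
    by (rule sum.swap)
  also have "\<dots> = (\<Sum>a<m. \<Sum>b<m. \<Sum>i<n. cnj (x a) * x b * (cnj (u i a) * u i b))"
    by (intro sum.cong refl sum.swap)
  finally show ?thesis by (simp only: sum_distrib_left)
qed

text \<open>Evaluating the Gram identity as a quadratic form at x shows that the squared norm of Ux
  is the sum of those of x and Vx.\<close>

lemma frame_bound_of_gram:
  fixes u v :: "nat \<Rightarrow> nat \<Rightarrow> complex"
  assumes gram: "\<And>a b. a < m \<Longrightarrow> b < m \<Longrightarrow> (\<Sum>i<n. cnj (u i a) * u i b)
      = (if a = b then 1 else 0) + (\<Sum>i<n. cnj (v i a) * v i b)"
  shows "(\<Sum>j<m. (cmod (x j))\<^sup>2) \<le> (\<Sum>i<n. (cmod (\<Sum>j<m. u i j * x j))\<^sup>2)"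
proof -
  have "complex_of_real (\<Sum>i<n. (cmod (\<Sum>j<m. u i j * x j))\<^sup>2)
      = (\<Sum>a<m. \<Sum>b<m. cnj (x a) * x b * ((if a = b then 1 else 0) + (\<Sum>i<n. cnj (v i a) * v i b)))"
    unfolding gram_quadratic_form by (intro sum.cong refl) (simp add: gram)
  also have "\<dots> = (\<Sum>a<m. \<Sum>b<m. if a = b then cnj (x a) * x b else 0)
      + (\<Sum>a<m. \<Sum>b<m. cnj (x a) * x b * (\<Sum>i<n. cnj (v i a) * v i b))"
    unfolding sum.distrib[symmetric] by (intro sum.cong refl) (simp add: distrib_left)
  also have "(\<Sum>a<m. \<Sum>b<m. if a = b then cnj (x a) * x b else 0) = (\<Sum>a<m. cnj (x a) * x a)"
    by simp
  also have "\<dots> = of_real (\<Sum>j<m. (cmod (x j))\<^sup>2)"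
    by (simp only: of_real_sum of_real_cmod_square)
  finally have "(\<Sum>i<n. (cmod (\<Sum>j<m. u i j * x j))\<^sup>2)
      = (\<Sum>j<m. (cmod (x j))\<^sup>2) + (\<Sum>i<n. (cmod (\<Sum>j<m. v i j * x j))\<^sup>2)"
    by (simp only: gram_quadratic_form[symmetric] of_real_add[symmetric] of_real_eq_iff)
  moreover have "0 \<le> (\<Sum>i<n. (cmod (\<Sum>j<m. v i j * x j))\<^sup>2)" by (simp add: sum_nonneg)
  ultimately show ?thesis by linarith
qed

section \<open>The weighted trace bound\<close>

text \<open>Every initial segment of columns inherits the frame bound, so all partial sums of
  \<open>T j - d j\<close> are nonnegative, and the lemma on decreasing weights applies.\<close>

lemma weighted_trace_bound:
  fixes u v :: "nat \<Rightarrow> nat \<Rightarrow> complex" and d \<mu> :: "nat \<Rightarrow> real" and n k :: nat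
  defines "T \<equiv> \<lambda>j. \<Sum>i<n. d i * ((cmod (u i j))\<^sup>2 + (cmod (v i j))\<^sup>2)"
  assumes k: "k \<le> n"
    and d: "\<And>i j. i \<le> j \<Longrightarrow> j < n \<Longrightarrow> d i \<le> d j" "\<And>i. i < n \<Longrightarrow> 0 < d i"
    and \<mu>: "\<And>j. j < k \<Longrightarrow> 0 < \<mu> j" "\<And>j. Suc j < k \<Longrightarrow> \<mu> (Suc j) < \<mu> j"
    and gram: "\<And>a b. a < k \<Longrightarrow> b < k \<Longrightarrow> (\<Sum>i<n. cnj (u i a) * u i b)
      = (if a = b then 1 else 0) + (\<Sum>i<n. cnj (v i a) * v i b)"
  shows "(\<Sum>j<k. \<mu> j * d j) \<le> (\<Sum>j<k. \<mu> j * T j)"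
    and "(\<Sum>j<k. \<mu> j * T j) = (\<Sum>j<k. \<mu> j * d j) \<Longrightarrow>
      (\<forall>i<n. \<forall>j<k. v i j = 0) \<and> orthonormal_columns n k u \<and> eigen_columns n d k d u"
proof -
  define tu where "tu j = (\<Sum>i<n. d i * (cmod (u i j))\<^sup>2)" for j
  define tv where "tv j = (\<Sum>i<n. d i * (cmod (v i j))\<^sup>2)" for j
  have T: "T j = tu j + tv j" for j
    by (simp add: T_def tu_def tv_def sum.distrib distrib_left)
  have tv0: "0 \<le> tv j" for j
    unfolding tv_def using d(2) by (intro sum_nonneg mult_nonneg_nonneg) (auto simp: less_imp_le)
  have frame: "(\<Sum>j<l. (cmod (x j))\<^sup>2) \<le> (\<Sum>i<n. (cmod (\<Sum>j<l. u i j * x j))\<^sup>2)"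
    if "l \<le> k" for l x
    by (rule frame_bound_of_gram[where v = v], rule gram) (use that in linarith)+
  have tu_ge: "(\<Sum>j<l. d j) \<le> (\<Sum>j<l. tu j)" if "0 < l" "l \<le> k" for l
  proof -
    have "l \<le> n" using that k by simp
    then show ?thesis
      unfolding tu_def
      by (rule frame_trace_bound(1)[where n = n and d = d, OF that(1) _ d frame[OF that(2)]])
  qed
  have S: "0 \<le> (\<Sum>j<l. T j - d j)" if "0 < l" "l \<le> k" for l
  proof -
    have "(\<Sum>j<l. T j - d j) = (\<Sum>j<l. tu j) - (\<Sum>j<l. d j) + (\<Sum>j<l. tv j)"
      by (simp add: T sum.distrib sum_subtractf)
    moreover have "0 \<le> (\<Sum>j<l. tv j)" using tv0 by (intro sum_nonneg) auto
    ultimately show ?thesis using tu_ge[OF that] by linarith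
  qed
  note abel = decreasing_weights_sum_nonneg[of k \<mu> "\<lambda>j. T j - d j", OF \<mu> S]
  have diff: "(\<Sum>j<k. \<mu> j * (T j - d j)) = (\<Sum>j<k. \<mu> j * T j) - (\<Sum>j<k. \<mu> j * d j)"
    by (simp add: right_diff_distrib sum_subtractf)
  show "(\<Sum>j<k. \<mu> j * d j) \<le> (\<Sum>j<k. \<mu> j * T j)" using abel(1) diff by simp
  assume eq: "(\<Sum>j<k. \<mu> j * T j) = (\<Sum>j<k. \<mu> j * d j)"
  \<comment> \<open>Strict decrease and positivity of the weights give equality for each j
    separately, not just for the sum.\<close>
  then have Tj: "T j = d j" if "j < k" for j using abel(2)[of j] diff that by simp
  have sumT: "(\<Sum>j<k. tu j) + (\<Sum>j<k. tv j) = (\<Sum>j<k. d j)"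
    using Tj by (simp add: T flip: sum.distrib)
  \<comment> \<open>The part from u alone already reaches the sum of the \<open>d j\<close>, which
    leaves nothing for v.\<close>
  have tvz: "tv j = 0" if "j < k" for j
  proof -
    have "(\<Sum>j<k. tv j) = 0"
      using sumT tu_ge[of k] that sum_nonneg[of "{..<k}" tv] tv0 by simp
    then show ?thesis using tv0 that by (subst (asm) sum_nonneg_eq_0_iff) auto
  qed
  have v0: "v i j = 0" if "i < n" "j < k" for i j
  proof -
    have "d i * (cmod (v i j))\<^sup>2 = 0"
      using tvz[OF that(2)] that(1) d(2) unfolding tv_def
      by (subst (asm) sum_nonneg_eq_0_iff) (auto simp: less_imp_le)
    then show ?thesis using d(2)[OF that(1)] by simp
  qed
  have tud: "tu j = d j" if "j < k" for j using Tj[OF that] tvz[OF that] T by simp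
  have on: "orthonormal_columns n k u"
    unfolding orthonormal_columns_def
  proof (intro allI impI)
    fix a b assume ab: "a < k" "b < k"
    have "(\<Sum>i<n. cnj (v i a) * v i b) = 0" using v0 ab by (intro sum.neutral) simp
    then show "(\<Sum>i<n. cnj (u i a) * u i b) = (if a = b then 1 else 0)" using gram[OF ab] by simp
  qed
  have "d i = d j" if i: "i < n" and j: "j < k" and nz: "u i j \<noteq> 0" for i j
  proof -
    \<comment> \<open>Tightness for the first \<open>Suc j\<close> columns, whose threshold is
      \<open>d j\<close>, kills the entries of column j at coordinates with larger d.\<close>
    have le: "d i' \<le> d j" if "i' < n" "u i' j \<noteq> 0" for i'
    proof (rule ccontr)
      assume "\<not> d i' \<le> d j"
      then have gt: "d (Suc j - 1) < d i'" by simp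
      have eq': "(\<Sum>j'<Suc j. \<Sum>i<n. d i * (cmod (u i j'))\<^sup>2) = (\<Sum>i<Suc j. d i)"
        using tud j unfolding tu_def by (intro sum.cong) auto
      have "Suc j \<le> n" using j k by simp
      then have "u i' j = 0"
        by (rule frame_trace_bound(2)[where l = "Suc j" and n = n and d = d,
              OF zero_less_Suc _ d frame[OF Suc_leI[OF j]] eq' that(1) lessI gt])
      with that show False by simp
    qed
    \<comment> \<open>Column j has unit norm, so \<open>tu j = d j\<close> is an average of d over
      its support. Since d is at most \<open>d j\<close> there, it is constant.\<close>
    have "(\<Sum>i<n. (d j - d i) * (cmod (u i j))\<^sup>2) = d j * (\<Sum>i<n. (cmod (u i j))\<^sup>2) - tu j"
      by (simp add: tu_def left_diff_distrib sum_subtractf sum_distrib_left)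
    also have "\<dots> = 0" using orthonormal_columns_norm[OF on j] tud[OF j] by simp
    finally have "(\<Sum>i<n. (d j - d i) * (cmod (u i j))\<^sup>2) = 0" .
    moreover have "0 \<le> (d j - d i') * (cmod (u i' j))\<^sup>2" if "i' < n" for i'
      using le[OF that] by (cases "u i' j = 0") auto
    ultimately have "(d j - d i) * (cmod (u i j))\<^sup>2 = 0"
      using i by (subst (asm) sum_nonneg_eq_0_iff) auto
    with nz show ?thesis by simp
  qed
  with on v0 show "(\<forall>i<n. \<forall>j<k. v i j = 0) \<and> orthonormal_columns n k u \<and> eigen_columns n d k d u"
    unfolding eigen_columns_def by blast
qed

section \<open>Symplectic matrices\<close>

lemma sum_lessThan_double: "(\<Sum>r<2 * n. f r) = (\<Sum>i<n. f i) + (\<Sum>i<n. f (n + i))"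
  for f :: "nat \<Rightarrow> 'a :: comm_monoid_add"
proof -
  have "(\<Sum>r<n + m. f r) = (\<Sum>i<n. f i) + (\<Sum>i<m. f (n + i))" for m
    by (induction m) (simp_all add: add.assoc)
  then show ?thesis by (simp add: mult_2)
qed

lemma less_double_cases:
  fixes r n :: nat
  assumes "r < 2 * n"
  obtains "r < n" | i where "i < n" "r = n + i"
proof (cases "r < n")
  case False
  then have "r = n + (r - n)" "r - n < n" using assms by auto
  then show ?thesis using that(2) by blast
qed

lemma eq_double_matI:
  assumes "B \<in> carrier_mat (2 * k) (2 * k)" "C \<in> carrier_mat (2 * k) (2 * k)"
    and "\<And>i j. i < k \<Longrightarrow> j < k \<Longrightarrow> B $$ (i, j) = C $$ (i, j) \<and> B $$ (i, k + j) = C $$ (i, k + j) \<and>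
      B $$ (k + i, j) = C $$ (k + i, j) \<and> B $$ (k + i, k + j) = C $$ (k + i, k + j)"
  shows "B = C"
proof (rule eq_matI)
  fix a b assume "a < dim_row C" "b < dim_col C"
  with assms(2) have "a < 2 * k" "b < 2 * k" by auto
  then show "B $$ (a, b) = C $$ (a, b)"
    using assms(3) by (elim less_double_cases) auto
qed (use assms in auto)

lemma congruence_carrier:
  "Y \<in> carrier_mat N m \<Longrightarrow> A \<in> carrier_mat N N \<Longrightarrow> transpose_mat Y * A * Y \<in> carrier_mat m m"
  by auto

lemma J_mat_carrier [simp]: "J_mat n \<in> carrier_mat (2 * n) (2 * n)"
  unfolding J_mat_def mult_2 by (intro four_block_carrier_mat) auto

lemma diag2_carrier [simp]: "diag2 n d \<in> carrier_mat (2 * n) (2 * n)"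
  by (simp add: diag2_def diag_of_def)

lemma J_mat_index:
  assumes "i < n" "j < n"
  shows "J_mat n $$ (i, j) = 0" "J_mat n $$ (n + i, n + j) = 0"
    "J_mat n $$ (i, n + j) = (if i = j then 1 else 0)"
    "J_mat n $$ (n + i, j) = (if i = j then -1 else 0)"
  using assms by (auto simp: J_mat_def)

lemma diag2_index:
  assumes "i < n" "j < n"
  shows "diag2 n d $$ (i, j) = (if i = j then d i else 0)"
    "diag2 n d $$ (n + i, n + j) = (if i = j then d i else 0)"
    "diag2 n d $$ (i, n + j) = 0" "diag2 n d $$ (n + i, j) = 0"
  using assms by (auto simp: diag2_def diag_of_def)

lemma bilinear_form_index:
  fixes A :: "'a :: comm_semiring_0 mat"
  assumes "Y \<in> carrier_mat N m" "A \<in> carrier_mat N N" "a < m" "b < m"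
  shows "(transpose_mat Y * A * Y) $$ (a, b) = (\<Sum>s<N. (\<Sum>r<N. Y $$ (r, a) * A $$ (r, s)) * Y $$ (s, b))"
proof -
  define P where "P = transpose_mat Y * A"
  have P: "P \<in> carrier_mat m N" using assms by (simp add: P_def)
  have "(P * Y) $$ (a, b) = (\<Sum>s<N. P $$ (a, s) * Y $$ (s, b))"
    using assms P by (simp add: scalar_prod_def atLeast0LessThan)
  also have "\<dots> = (\<Sum>s<N. (\<Sum>r<N. Y $$ (r, a) * A $$ (r, s)) * Y $$ (s, b))"
    using assms by (intro sum.cong refl arg_cong2[where f = "(*)"])
      (simp_all add: P_def scalar_prod_def atLeast0LessThan)
  finally show ?thesis by (simp only: P_def)
qed

lemma J_form_index:
  assumes "Y \<in> carrier_mat (2 * n) m" "a < m" "b < m"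
  shows "(transpose_mat Y * J_mat n * Y) $$ (a, b)
    = (\<Sum>i<n. Y $$ (i, a) * Y $$ (n + i, b) - Y $$ (n + i, a) * Y $$ (i, b))"
proof -
  have "(\<Sum>r<2 * n. Y $$ (r, a) * J_mat n $$ (r, s)) = - Y $$ (n + s, a)" if "s < n" for s
    using that by (simp add: sum_lessThan_double J_mat_index if_distrib[of "(*) _"] cong: if_cong)
  moreover have "(\<Sum>r<2 * n. Y $$ (r, a) * J_mat n $$ (r, n + s)) = Y $$ (s, a)" if "s < n" for s
    using that by (simp add: sum_lessThan_double J_mat_index if_distrib[of "(*) _"] cong: if_cong)
  ultimately show ?thesis
    unfolding bilinear_form_index[OF assms(1) J_mat_carrier assms(2,3)]
    by (subst sum_lessThan_double) (simp add: sum_subtractf sum_negf)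
qed

lemma diag2_form_index:
  assumes "Y \<in> carrier_mat (2 * n) m" "a < m" "b < m"
  shows "(transpose_mat Y * diag2 n d * Y) $$ (a, b)
    = (\<Sum>i<n. d i * (Y $$ (i, a) * Y $$ (i, b) + Y $$ (n + i, a) * Y $$ (n + i, b)))"
proof -
  have "(\<Sum>r<2 * n. Y $$ (r, a) * diag2 n d $$ (r, s)) = Y $$ (s, a) * d s" if "s < n" for s
    using that by (simp add: sum_lessThan_double diag2_index if_distrib[of "(*) _"] cong: if_cong)
  moreover have "(\<Sum>r<2 * n. Y $$ (r, a) * diag2 n d $$ (r, n + s)) = Y $$ (n + s, a) * d s" if "s < n" for s
    using that by (simp add: sum_lessThan_double diag2_index if_distrib[of "(*) _"] cong: if_cong)
  ultimately show ?thesis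
    unfolding bilinear_form_index[OF assms(1) diag2_carrier assms(2,3)]
    by (subst sum_lessThan_double) (simp add: sum.distrib algebra_simps)
qed

lemma mat_trace_diag2_mult:
  assumes "B \<in> carrier_mat (2 * k) (2 * k)"
  shows "mat_trace (diag2 k \<nu> * B) = (\<Sum>j<k. \<nu> j * (B $$ (j, j) + B $$ (k + j, k + j)))"
proof -
  have "(diag2 k \<nu> * B) $$ (c, c) = (\<Sum>r<2 * k. diag2 k \<nu> $$ (c, r) * B $$ (r, c))" if "c < 2 * k" for c
    using assms that carrier_matD[OF diag2_carrier[of k \<nu>]]
    by (simp add: scalar_prod_def atLeast0LessThan)
  then have "mat_trace (diag2 k \<nu> * B) = (\<Sum>c<2 * k. \<Sum>r<2 * k. diag2 k \<nu> $$ (c, r) * B $$ (r, c))"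
    using carrier_matD[OF diag2_carrier[of k \<nu>]] by (simp add: mat_trace_def)
  also have "\<dots> = (\<Sum>j<k. \<nu> j * B $$ (j, j)) + (\<Sum>j<k. \<nu> j * B $$ (k + j, k + j))"
    by (simp add: sum_lessThan_double diag2_index if_distrib[of "\<lambda>x. x * _"] cong: if_cong)
  finally show ?thesis by (simp add: sum.distrib distrib_left)
qed

text \<open>Selecting columns of S turns the congruence into a submatrix of the full one. A general
  A covers both \<open>J_mat n\<close> and M.\<close>

lemma sel_cols_form_index:
  assumes S: "S \<in> carrier_mat (2 * n) (2 * n)" and A: "A \<in> carrier_mat (2 * n) (2 * n)"
    and I: "length I = k" "set I \<subseteq> {..<n}"
    and ab: "a < 2 * k" "b < 2 * k"
  defines "\<phi> \<equiv> \<lambda>c. if c < k then I ! c else n + I ! (c - k)"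
  shows "(transpose_mat (sel_cols n S I) * A * sel_cols n S I) $$ (a, b)
    = (transpose_mat S * A * S) $$ (\<phi> a, \<phi> b)"
proof -
  have X: "sel_cols n S I \<in> carrier_mat (2 * n) (2 * k)"
    using S I by (simp add: sel_cols_def)
  have In: "I ! j < n" if "j < k" for j
    using nth_mem[of j I] I that by blast
  have \<phi>: "\<phi> c < 2 * n" if "c < 2 * k" for c
    using In[of c] In[of "c - k"] that by (auto simp: \<phi>_def)
  have idx: "sel_cols n S I $$ (r, c) = S $$ (r, \<phi> c)" if "r < 2 * n" "c < 2 * k" for r c
    using that S I by (simp add: sel_cols_def \<phi>_def)
  show ?thesis
    unfolding bilinear_form_index[OF X A ab] bilinear_form_index[OF S A \<phi>[OF ab(1)] \<phi>[OF ab(2)]]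
    using ab by (intro sum.cong refl arg_cong2[where f = "(*)"]) (simp_all add: idx)
qed

text \<open>Both identities are read off from the selected submatrices; distinct indices keep the
  Kronecker deltas intact. This serves the attainment as well as the final form of a
  minimizer.\<close>

lemma sel_cols_symplectic_eigen:
  assumes W: "williamson n M S D" and M: "M \<in> carrier_mat (2 * n) (2 * n)"
    and I: "length I = k" "distinct I" "set I \<subseteq> {..<n}"
    and e: "\<And>j. j < k \<Longrightarrow> D (I ! j) = e j"
  shows "sel_cols n S I \<in> carrier_mat (2 * n) (2 * k)"
    and "transpose_mat (sel_cols n S I) * J_mat n * sel_cols n S I = J_mat k"
    and "transpose_mat (sel_cols n S I) * M * sel_cols n S I = diag2 k e"
proof -
  have S: "S \<in> carrier_mat (2 * n) (2 * n)" and SJ: "transpose_mat S * J_mat n * S = J_mat n"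
    and SM: "transpose_mat S * M * S = diag2 n D"
    using W by (auto simp: williamson_def symplectic_def)
  show X: "sel_cols n S I \<in> carrier_mat (2 * n) (2 * k)"
    using S I by (simp add: sel_cols_def)
  have In: "I ! j < n" if "j < k" for j using nth_mem[of j I] I that by blast
  have Ieq: "I ! i = I ! j \<longleftrightarrow> i = j" if "i < k" "j < k" for i j
    using nth_eq_iff_index_eq[of I i j] I that by blast
  have XT: "transpose_mat (sel_cols n S I) * A * sel_cols n S I \<in> carrier_mat (2 * k) (2 * k)"
    if "A \<in> carrier_mat (2 * n) (2 * n)" for A
    using X that by auto
  show "transpose_mat (sel_cols n S I) * J_mat n * sel_cols n S I = J_mat k"
    by (rule eq_double_matI[OF XT[OF J_mat_carrier] J_mat_carrier])
      (simp add: sel_cols_form_index[OF S J_mat_carrier I(1,3)] SJ J_mat_index In Ieq)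
  show "transpose_mat (sel_cols n S I) * M * sel_cols n S I = diag2 k e"
    by (rule eq_double_matI[OF XT[OF M] diag2_carrier])
      (simp add: sel_cols_form_index[OF S M I(1,3)] SM diag2_index In Ieq e)
qed

section \<open>Unitary matrices as real symplectic matrices\<close>

definition realification :: "nat \<Rightarrow> (nat \<Rightarrow> nat \<Rightarrow> complex) \<Rightarrow> real mat" where
  "realification n u = mat (2 * n) (2 * n) (\<lambda>(r, c).
     if c < n then (if r < n then Re (u r c) else Im (u (r - n) c))
     else (if r < n then - Im (u r (c - n)) else Re (u (r - n) (c - n))))"

lemma realification_carrier [simp]: "realification n u \<in> carrier_mat (2 * n) (2 * n)"
  by (simp add: realification_def)

lemma realification_index:
  assumes "i < n" "j < n"
  shows "realification n u $$ (i, j) = Re (u i j)" "realification n u $$ (n + i, j) = Im (u i j)"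
    "realification n u $$ (i, n + j) = - Im (u i j)" "realification n u $$ (n + i, n + j) = Re (u i j)"
  using assms by (simp_all add: realification_def)

text \<open>The symplectic products of the real columns are, up to sign, the real and imaginary
  parts of the Hermitian inner products, so unitarity gives all four blocks.\<close>

lemma symplectic_realification:
  assumes "orthonormal_columns n n u"
  shows "symplectic n (realification n u)"
proof -
  have gram: "(\<Sum>i<n. cnj (u i a) * u i b) = (if a = b then 1 else 0)" if "a < n" "b < n" for a b
    using assms that by (simp add: orthonormal_columns_def)
  have re: "(\<Sum>i<n. Re (u i a) * Re (u i b) + Im (u i a) * Im (u i b)) = (if a = b then 1 else 0)"
    and im: "(\<Sum>i<n. Re (u i a) * Im (u i b) - Im (u i a) * Re (u i b)) = 0"
    if "a < n" "b < n" for a b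
    using arg_cong[OF gram[OF that], of Re] arg_cong[OF gram[OF that], of Im]
    by (simp_all split: if_splits)
  have "transpose_mat (realification n u) * J_mat n * realification n u = J_mat n"
  proof (rule eq_double_matI[OF congruence_carrier[OF realification_carrier J_mat_carrier] J_mat_carrier],
      intro conjI)
    fix a b assume ab: "a < n" "b < n"
    note idx = J_form_index[OF realification_carrier] realification_index J_mat_index
    let ?F = "transpose_mat (realification n u) * J_mat n * realification n u"
    have "?F $$ (a, b) = (\<Sum>i<n. Re (u i a) * Im (u i b) - Im (u i a) * Re (u i b))"
      using ab by (simp add: idx)
    then show "?F $$ (a, b) = J_mat n $$ (a, b)"
      using im[OF ab] J_mat_index(1)[OF ab] by (simp only:)
    have "?F $$ (n + a, n + b) = (\<Sum>i<n. - Im (u i a) * Re (u i b) - Re (u i a) * - Im (u i b))"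
      using ab by (simp add: idx)
    also have "\<dots> = (\<Sum>i<n. Re (u i a) * Im (u i b) - Im (u i a) * Re (u i b))"
      by (intro sum.cong) simp_all
    finally show "?F $$ (n + a, n + b) = J_mat n $$ (n + a, n + b)"
      using im[OF ab] J_mat_index(2)[OF ab] by (simp only:)
    show "?F $$ (a, n + b) = J_mat n $$ (a, n + b)"
      using re[OF ab] ab by (simp add: idx)
    have "?F $$ (n + a, b) = (\<Sum>i<n. - Im (u i a) * Im (u i b) - Re (u i a) * Re (u i b))"
      using ab by (simp add: idx)
    also have "\<dots> = - (\<Sum>i<n. Re (u i a) * Re (u i b) + Im (u i a) * Im (u i b))"
      unfolding sum_negf[symmetric] by (intro sum.cong) simp_all
    finally show "?F $$ (n + a, b) = J_mat n $$ (n + a, b)"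
      using re[OF ab] J_mat_index(4)[OF ab] by simp
  qed
  then show ?thesis by (simp add: symplectic_def)
qed

text \<open>On the support of an eigencolumn d can be replaced by its eigenvalue, so the weighted
  Gram matrix is diagonal. Its real part gives the diagonal blocks and its imaginary part the
  off-diagonal ones.\<close>

lemma diag2_realification:
  assumes "orthonormal_columns n n u" "eigen_columns n d n f u"
  shows "transpose_mat (realification n u) * diag2 n d * realification n u = diag2 n f"
proof -
  have gram: "(\<Sum>i<n. of_real (d i) * (cnj (u i a) * u i b)) = (if a = b then of_real (f b) else 0)"
    if ab: "a < n" "b < n" for a b
  proof -
    have "(\<Sum>i<n. of_real (d i) * (cnj (u i a) * u i b)) = (\<Sum>i<n. of_real (f b) * (cnj (u i a) * u i b))"
    proof (intro sum.cong refl)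
      fix i assume "i \<in> {..<n}"
      then show "of_real (d i) * (cnj (u i a) * u i b) = of_real (f b) * (cnj (u i a) * u i b)"
        using assms(2) ab by (cases "u i b = 0") (simp_all add: eigen_columns_def)
    qed
    also have "\<dots> = of_real (f b) * (\<Sum>i<n. cnj (u i a) * u i b)"
      by (simp only: sum_distrib_left)
    also have "\<dots> = (if a = b then of_real (f b) else 0)"
      using assms(1) ab by (simp add: orthonormal_columns_def)
    finally show ?thesis .
  qed
  have re: "(\<Sum>i<n. d i * (Re (u i a) * Re (u i b) + Im (u i a) * Im (u i b))) = (if a = b then f b else 0)"
    and im: "(\<Sum>i<n. d i * (Re (u i a) * Im (u i b) - Im (u i a) * Re (u i b))) = 0"
    if "a < n" "b < n" for a b
    using arg_cong[OF gram[OF that], of Re] arg_cong[OF gram[OF that], of Im]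
    by (simp_all split: if_splits)
  show ?thesis
  proof (rule eq_double_matI[OF congruence_carrier[OF realification_carrier diag2_carrier] diag2_carrier],
      intro conjI)
    fix a b assume ab: "a < n" "b < n"
    note idx = diag2_form_index[OF realification_carrier] realification_index diag2_index
    let ?F = "transpose_mat (realification n u) * diag2 n d * realification n u"
    show "?F $$ (a, b) = diag2 n f $$ (a, b)"
      using re[OF ab] ab by (simp add: idx)
    have "?F $$ (n + a, n + b) = (\<Sum>i<n. d i * (Im (u i a) * Im (u i b) + Re (u i a) * Re (u i b)))"
      using ab by (simp add: idx)
    then show "?F $$ (n + a, n + b) = diag2 n f $$ (n + a, n + b)"
      using re[OF ab] diag2_index(2)[OF ab] by (simp add: add.commute)
    have "?F $$ (a, n + b) = (\<Sum>i<n. d i * (Re (u i a) * - Im (u i b) + Im (u i a) * Re (u i b)))"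
      using ab by (simp add: idx)
    also have "\<dots> = - (\<Sum>i<n. d i * (Re (u i a) * Im (u i b) - Im (u i a) * Re (u i b)))"
      unfolding sum_negf[symmetric] by (intro sum.cong) (simp_all add: algebra_simps)
    finally show "?F $$ (a, n + b) = diag2 n f $$ (a, n + b)"
      using im[OF ab] diag2_index(3)[OF ab] by simp
    have "?F $$ (n + a, b) = (\<Sum>i<n. d i * (- Im (u i a) * Re (u i b) + Re (u i a) * Im (u i b)))"
      using ab by (simp add: idx)
    also have "\<dots> = (\<Sum>i<n. d i * (Re (u i a) * Im (u i b) - Im (u i a) * Re (u i b)))"
      by (intro sum.cong) simp_all
    finally show "?F $$ (n + a, b) = diag2 n f $$ (n + a, b)"
      using im[OF ab] diag2_index(4)[OF ab] by simp
  qed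
qed

text \<open>With \<open>(p, q) \<in> \<real>\<^sup>2\<^sup>n\<close> read as \<open>p + iq\<close>, multiplication by \<open>J\<close> is multiplication by \<open>-i\<close>. For the
  \<open>j\<close>-th column pair \<open>(a, b)\<close> of \<open>Y\<close>, \<open>hol_part\<close> is \<open>(a - ib)/2\<close> and \<open>antihol_part\<close> is the conjugate of
  \<open>(a + ib)/2\<close>; conjugating makes the Gram identity below free of transposes.\<close>

definition hol_part :: "nat \<Rightarrow> nat \<Rightarrow> real mat \<Rightarrow> nat \<Rightarrow> nat \<Rightarrow> complex" where
  "hol_part n k Y i j =
     Complex ((Y $$ (i, j) + Y $$ (n + i, k + j)) / 2) ((Y $$ (n + i, j) - Y $$ (i, k + j)) / 2)"

definition antihol_part :: "nat \<Rightarrow> nat \<Rightarrow> real mat \<Rightarrow> nat \<Rightarrow> nat \<Rightarrow> complex" where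
  "antihol_part n k Y i j =
     Complex ((Y $$ (i, j) - Y $$ (n + i, k + j)) / 2) (- (Y $$ (n + i, j) + Y $$ (i, k + j)) / 2)"

text \<open>In the difference of the two Gram matrices all terms cancel except symplectic products
  of columns of Y, written \<open>F\<close>, and the constraint fixes their values.\<close>

lemma symplectic_gram:
  assumes Y: "Y \<in> carrier_mat (2 * n) (2 * k)" and J: "transpose_mat Y * J_mat n * Y = J_mat k"
    and ab: "a < k" "b < k"
  shows "(\<Sum>i<n. cnj (hol_part n k Y i a) * hol_part n k Y i b)
    = (if a = b then 1 else 0) + (\<Sum>i<n. cnj (antihol_part n k Y i a) * antihol_part n k Y i b)"
proof -
  let ?u = "hol_part n k Y" and ?v = "antihol_part n k Y"
  define F where "F a b i = Y $$ (i, a) * Y $$ (n + i, b) - Y $$ (n + i, a) * Y $$ (i, b)" for a b i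
  have F: "(\<Sum>i<n. F a b i) = J_mat k $$ (a, b)" if "a < 2 * k" "b < 2 * k" for a b
    using J_form_index[OF Y that] J by (simp add: F_def)
  have "(\<Sum>i<n. cnj (?u i a) * ?u i b) - (\<Sum>i<n. cnj (?v i a) * ?v i b)
      = (\<Sum>i<n. Complex ((F a (k + b) i + F b (k + a) i) / 2) ((F a b i + F (k + a) (k + b) i) / 2))"
    unfolding sum_subtractf[symmetric]
    by (intro sum.cong refl complex_eqI)
      (simp_all add: hol_part_def antihol_part_def F_def field_simps)
  also have "\<dots> = Complex (((\<Sum>i<n. F a (k + b) i) + (\<Sum>i<n. F b (k + a) i)) / 2)
      (((\<Sum>i<n. F a b i) + (\<Sum>i<n. F (k + a) (k + b) i)) / 2)"
    by (intro complex_eqI) (simp_all add: Re_sum Im_sum sum.distrib flip: sum_divide_distrib)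
  also have "\<dots> = (if a = b then 1 else 0)"
    using ab by (simp add: F J_mat_index complex_eq_iff)
  finally show ?thesis by (simp only: diff_eq_eq)
qed

text \<open>The parallelogram law for a and ib, taken coordinate by coordinate.\<close>

lemma norm_hol_antihol_part:
  "2 * ((cmod (hol_part n k Y i j))\<^sup>2 + (cmod (antihol_part n k Y i j))\<^sup>2)
    = (Y $$ (i, j))\<^sup>2 + (Y $$ (n + i, j))\<^sup>2 + ((Y $$ (i, k + j))\<^sup>2 + (Y $$ (n + i, k + j))\<^sup>2)"
  unfolding hol_part_def antihol_part_def cmod_power2 complex.sel
  by (simp add: power2_eq_square field_simps)

text \<open>Columns j and k + j share the weight \<open>\<nu> j\<close>, and rows i and n + i share
  \<open>d i\<close>, so the parallelogram law applies under both weights.\<close>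

lemma trace_eq_hol_antihol:
  assumes Y: "Y \<in> carrier_mat (2 * n) (2 * k)"
  shows "mat_trace (diag2 k \<nu> * (transpose_mat Y * diag2 n d * Y))
    = 2 * (\<Sum>j<k. \<nu> j * (\<Sum>i<n. d i * ((cmod (hol_part n k Y i j))\<^sup>2 + (cmod (antihol_part n k Y i j))\<^sup>2)))"
proof -
  have "(transpose_mat Y * diag2 n d * Y) $$ (j, j) + (transpose_mat Y * diag2 n d * Y) $$ (k + j, k + j)
      = 2 * (\<Sum>i<n. d i * ((cmod (hol_part n k Y i j))\<^sup>2 + (cmod (antihol_part n k Y i j))\<^sup>2))"
    if "j < k" for j
  proof -
    have "(transpose_mat Y * diag2 n d * Y) $$ (j, j) + (transpose_mat Y * diag2 n d * Y) $$ (k + j, k + j)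
        = (\<Sum>i<n. d i * ((Y $$ (i, j))\<^sup>2 + (Y $$ (n + i, j))\<^sup>2 + ((Y $$ (i, k + j))\<^sup>2 + (Y $$ (n + i, k + j))\<^sup>2)))"
      using that by (simp add: diag2_form_index[OF Y] power2_eq_square distrib_left sum.distrib)
    also have "\<dots> = (\<Sum>i<n. 2 * (d i * ((cmod (hol_part n k Y i j))\<^sup>2 + (cmod (antihol_part n k Y i j))\<^sup>2)))"
      unfolding norm_hol_antihol_part[symmetric] by (intro sum.cong refl) (simp only: mult.left_commute)
    finally show ?thesis by (simp only: sum_distrib_left)
  qed
  then have "mat_trace (diag2 k \<nu> * (transpose_mat Y * diag2 n d * Y))
    = (\<Sum>j<k. 2 * (\<nu> j * (\<Sum>i<n. d i * ((cmod (hol_part n k Y i j))\<^sup>2 + (cmod (antihol_part n k Y i j))\<^sup>2))))"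
    unfolding mat_trace_diag2_mult[OF congruence_carrier[OF Y diag2_carrier]]
    by (intro sum.cong refl) (simp add: mult.left_commute)
  then show ?thesis by (simp only: sum_distrib_left)
qed

section \<open>Inverses and changes of symplectic basis\<close>

lemma J_mat_square: "J_mat n * J_mat n = - 1\<^sub>m (2 * n)"
proof (rule eq_double_matI)
  show "J_mat n * J_mat n \<in> carrier_mat (2 * n) (2 * n)"
    using J_mat_carrier[of n] by (rule mult_carrier_mat) (rule J_mat_carrier)
next
  fix i j assume ij: "i < n" "j < n"
  have JJ: "(J_mat n * J_mat n) $$ (a, b) = (\<Sum>r<2 * n. J_mat n $$ (a, r) * J_mat n $$ (r, b))"
    if "a < 2 * n" "b < 2 * n" for a b
    using that carrier_matD[OF J_mat_carrier[of n]] by (simp add: scalar_prod_def atLeast0LessThan)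
  show "(J_mat n * J_mat n) $$ (i, j) = (- 1\<^sub>m (2 * n)) $$ (i, j) \<and>
    (J_mat n * J_mat n) $$ (i, n + j) = (- 1\<^sub>m (2 * n)) $$ (i, n + j) \<and>
    (J_mat n * J_mat n) $$ (n + i, j) = (- 1\<^sub>m (2 * n)) $$ (n + i, j) \<and>
    (J_mat n * J_mat n) $$ (n + i, n + j) = (- 1\<^sub>m (2 * n)) $$ (n + i, n + j)"
    using ij by (simp add: JJ sum_lessThan_double J_mat_index if_distrib[of "\<lambda>x. x * _"] cong: if_cong)
qed simp

text \<open>The constraint and J^2 = -I make \<open>Q\<close> = -J S^T J a left inverse, and a left
  inverse of a square matrix is also a right inverse.\<close>

lemma symplectic_inverse:
  assumes "symplectic n S"
  obtains Q where "Q \<in> carrier_mat (2 * n) (2 * n)" "S * Q = 1\<^sub>m (2 * n)"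
proof -
  note J = J_mat_carrier[of n]
  have S: "S \<in> carrier_mat (2 * n) (2 * n)" and SJ: "transpose_mat S * J_mat n * S = J_mat n"
    using assms by (auto simp: symplectic_def)
  have SJc: "transpose_mat S * J_mat n \<in> carrier_mat (2 * n) (2 * n)"
    using S J by auto
  define Q where "Q = - (J_mat n * (transpose_mat S * J_mat n))"
  have JSJ: "J_mat n * (transpose_mat S * J_mat n) \<in> carrier_mat (2 * n) (2 * n)"
    using J SJc by (rule mult_carrier_mat)
  then have Q: "Q \<in> carrier_mat (2 * n) (2 * n)"
    by (simp add: Q_def)
  have "Q * S = - (J_mat n * (transpose_mat S * J_mat n) * S)"
    unfolding Q_def using JSJ S by (intro uminus_mult_left_mat) auto
  also have "\<dots> = - (J_mat n * (transpose_mat S * J_mat n * S))"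
    by (simp only: assoc_mult_mat[OF J SJc S])
  also have "\<dots> = 1\<^sub>m (2 * n)"
    by (simp only: SJ J_mat_square uminus_uminus_mat)
  finally have "S * Q = 1\<^sub>m (2 * n)" by (rule mat_mult_left_right_inverse[OF Q S])
  then show thesis using that Q by blast
qed

lemma congruence_mult:
  fixes S :: "'a :: comm_ring_1 mat"
  assumes "S \<in> carrier_mat N N" "Y \<in> carrier_mat N m" "A \<in> carrier_mat N N"
  shows "transpose_mat (S * Y) * A * (S * Y) = transpose_mat Y * (transpose_mat S * A * S) * Y"
proof -
  have T: "transpose_mat S \<in> carrier_mat N N" "transpose_mat Y \<in> carrier_mat m N"
    using assms by auto
  have SA: "transpose_mat S * A \<in> carrier_mat N N" using T assms by auto
  have "transpose_mat (S * Y) * A * (S * Y) = transpose_mat Y * transpose_mat S * A * (S * Y)"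
    using assms by (simp only: transpose_mult)
  also have "\<dots> = transpose_mat Y * (transpose_mat S * A) * (S * Y)"
    by (simp only: assoc_mult_mat[OF T(2,1) assms(3)])
  also have "\<dots> = transpose_mat Y * (transpose_mat S * A) * S * Y"
    by (rule assoc_mult_mat[OF mult_carrier_mat[OF T(2) SA] assms(1,2), symmetric])
  also have "transpose_mat Y * (transpose_mat S * A) * S = transpose_mat Y * (transpose_mat S * A * S)"
    by (rule assoc_mult_mat[OF T(2) SA assms(1)])
  finally show ?thesis .
qed

text \<open>A diagonalizer stays one after a unitary change of basis along eigenvectors of the
  diagonal matrix of d; the entries of f need not be sorted.\<close>

lemma williamson_realification:
  assumes W: "williamson n M S d" and M: "M \<in> carrier_mat (2 * n) (2 * n)"
    and u: "orthonormal_columns n n u" "eigen_columns n d n f u"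
  shows "williamson n M (S * realification n u) f"
proof -
  let ?R = "realification n u"
  have S: "S \<in> carrier_mat (2 * n) (2 * n)" and SJ: "transpose_mat S * J_mat n * S = J_mat n"
    and SM: "transpose_mat S * M * S = diag2 n d" and d: "\<forall>j<n. 0 < d j"
    using W by (auto simp: williamson_def symplectic_def)
  have R: "transpose_mat ?R * J_mat n * ?R = J_mat n"
    using symplectic_realification[OF u(1)] by (simp add: symplectic_def)
  have "symplectic n (S * ?R)"
    using S R by (simp add: symplectic_def congruence_mult[OF S realification_carrier J_mat_carrier] SJ
        mult_carrier_mat[OF S realification_carrier])
  moreover have "transpose_mat (S * ?R) * M * (S * ?R) = diag2 n f"
    by (simp add: congruence_mult[OF S realification_carrier M] SM diag2_realification[OF u])
  \<comment> \<open>A unit column has a nonzero entry, and there \<open>f j\<close> coincides with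
    some \<open>d i\<close>.\<close>
  moreover have "0 < f j" if j: "j < n" for j
  proof -
    have "(\<Sum>i<n. (cmod (u i j))\<^sup>2) \<noteq> 0"
      using orthonormal_columns_norm[OF u(1) j] by simp
    then obtain i where "i \<in> {..<n}" "(cmod (u i j))\<^sup>2 \<noteq> 0"
      by (rule sum.not_neutral_contains_not_neutral)
    then have "i < n" "d i = f j" using u(2) j by (auto simp: eigen_columns_def)
    then show ?thesis using d by auto
  qed
  ultimately show ?thesis by (simp add: williamson_def)
qed

text \<open>A vanishing antiholomorphic part means b = ia for each pair (a, b), so the holomorphic
  part is a itself and the pair is a column pair of a realification. The list is reversed because u
  is indexed by increasing d.\<close>

lemma hol_part_realification:
  assumes Y: "Y \<in> carrier_mat (2 * n) (2 * k)" and k: "k \<le> n"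
    and v: "\<And>i j. i < n \<Longrightarrow> j < k \<Longrightarrow> antihol_part n k Y i j = 0"
    and u: "\<And>i j. j < k \<Longrightarrow> u i (k - 1 - j) = hol_part n k Y i j"
    and S: "S \<in> carrier_mat (2 * n) (2 * n)"
  shows "S * Y = sel_cols n (S * realification n u) (rev [0..<k])"
proof (rule eq_matI)
  let ?R = "realification n u"
  define \<phi> where "\<phi> c = (if c < k then k - 1 - c else n + (k - 1 - (c - k)))" for c
  have YR: "Y $$ (r, c) = ?R $$ (r, \<phi> c)" if "r < 2 * n" "c < 2 * k" for r c
  proof -
    have *: "Y $$ (i, j) = ?R $$ (i, k - 1 - j) \<and> Y $$ (n + i, j) = ?R $$ (n + i, k - 1 - j) \<and>
        Y $$ (i, k + j) = ?R $$ (i, n + (k - 1 - j)) \<and> Y $$ (n + i, k + j) = ?R $$ (n + i, n + (k - 1 - j))"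
      if "i < n" "j < k" for i j
    proof -
      define j' where "j' = k - 1 - j"
      have "j' < n" "u i j' = hol_part n k Y i j" using that k u[OF that(2)] by (auto simp: j'_def)
      then show ?thesis
        using v[OF that] that(1) unfolding j'_def[symmetric]
        by (auto simp: realification_index hol_part_def antihol_part_def complex_eq_iff)
    qed
    show ?thesis
      using that
    proof (elim less_double_cases)
    qed (use * in \<open>auto simp: \<phi>_def\<close>)
  qed
  fix r c
  assume rc: "r < dim_row (sel_cols n (S * ?R) (rev [0..<k]))" "c < dim_col (sel_cols n (S * ?R) (rev [0..<k]))"
  then have r: "r < 2 * n" and c: "c < 2 * k" using S by (auto simp: sel_cols_def)
  have \<phi>: "\<phi> c < 2 * n" using c k by (auto simp: \<phi>_def)
  have "sel_cols n (S * ?R) (rev [0..<k]) $$ (r, c) = (S * ?R) $$ (r, \<phi> c)"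
    using r c S by (auto simp: sel_cols_def \<phi>_def rev_nth)
  also have "\<dots> = (\<Sum>s<2 * n. S $$ (r, s) * ?R $$ (s, \<phi> c))"
    using r \<phi> S carrier_matD[OF realification_carrier[of n u]]
    by (simp add: scalar_prod_def atLeast0LessThan)
  also have "\<dots> = (\<Sum>s<2 * n. S $$ (r, s) * Y $$ (s, c))"
    using c by (simp add: YR)
  also have "\<dots> = (S * Y) $$ (r, c)"
    using r c S Y by (simp add: scalar_prod_def atLeast0LessThan)
  finally show "(S * Y) $$ (r, c) = sel_cols n (S * ?R) (rev [0..<k]) $$ (r, c)" by simp
qed (use S Y in \<open>auto simp: sel_cols_def\<close>)

section \<open>The minimum of the weighted trace and its minimizers\<close>

theorem theorem3p5:
  fixes n k :: nat and M :: "real mat" and d \<nu> :: "nat \<Rightarrow> real"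
  assumes "1 \<le> k" and "k \<le> n"
    and "sym_pos_def (2*n) M"
    and "\<exists>S. williamson n M S d"
    and "\<forall>i j. i \<le> j \<longrightarrow> j < n \<longrightarrow> d i \<le> d j"
    and "0 < \<nu> 0"
    and "\<forall>i j. i < j \<longrightarrow> j < k \<longrightarrow> \<nu> i < \<nu> j"
  shows "(\<exists>X. X \<in> carrier_mat (2*n) (2*k) \<and> transpose_mat X * J_mat n * X = J_mat k \<and>
            mat_trace (diag2 k \<nu> * (transpose_mat X * M * X)) = 2 * (\<Sum>j<k. d j * \<nu> (k - 1 - j)))
       \<and> (\<forall>X. X \<in> carrier_mat (2*n) (2*k) \<longrightarrow> transpose_mat X * J_mat n * X = J_mat k \<longrightarrow>
            2 * (\<Sum>j<k. d j * \<nu> (k - 1 - j)) \<le> mat_trace (diag2 k \<nu> * (transpose_mat X * M * X)))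
       \<and> (\<forall>X. X \<in> carrier_mat (2*n) (2*k) \<longrightarrow> transpose_mat X * J_mat n * X = J_mat k \<longrightarrow>
            mat_trace (diag2 k \<nu> * (transpose_mat X * M * X)) = 2 * (\<Sum>j<k. d j * \<nu> (k - 1 - j)) \<longrightarrow>
            sympl_eigvec_set n M k (\<lambda>j. d (k - 1 - j)) X \<and>
            transpose_mat X * M * X = diag2 k (\<lambda>j. d (k - 1 - j)))"
proof -
  obtain S where W: "williamson n M S d" using assms(4) by blast
  have M: "M \<in> carrier_mat (2 * n) (2 * n)" using assms(3) by (simp add: sym_pos_def_def)
  have S: "S \<in> carrier_mat (2 * n) (2 * n)" and symS: "symplectic n S"
    and SJ: "transpose_mat S * J_mat n * S = J_mat n"
    and SM: "transpose_mat S * M * S = diag2 n d"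
    and dpos: "\<And>j. j < n \<Longrightarrow> 0 < d j"
    using W by (auto simp: williamson_def symplectic_def)
  have mono: "d i \<le> d j" if "i \<le> j" "j < n" for i j using assms(5) that by blast
  \<comment> \<open>Reversing the weights makes them decreasing, so that they match increasing d as
    the weighted trace bound requires.\<close>
  define \<mu> where "\<mu> j = \<nu> (k - 1 - j)" for j
  have rev_sum: "(\<Sum>j<k. \<nu> j * f j) = (\<Sum>j<k. \<mu> j * f (k - 1 - j))" for f
    unfolding \<mu>_def by (subst sum.nat_diff_reindex[symmetric]) simp
  have opt: "(\<Sum>j<k. d j * \<nu> (k - 1 - j)) = (\<Sum>j<k. \<mu> j * d j)"
    by (simp add: \<mu>_def mult.commute)
  have \<mu>pos: "0 < \<mu> j" if "j < k" for j
  proof (cases "k - 1 - j = 0")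
    case False
    then have "\<nu> 0 < \<nu> (k - 1 - j)" using assms(7) that by auto
    then show ?thesis using assms(6) by (simp add: \<mu>_def)
  qed (simp add: \<mu>_def assms(6))
  have \<mu>dec: "\<mu> (Suc j) < \<mu> j" if "Suc j < k" for j
    using assms(7) that by (simp add: \<mu>_def)
  have I: "length (rev [0..<k]) = k" "distinct (rev [0..<k])" "set (rev [0..<k]) \<subseteq> {..<n}"
    using assms(2) by auto
  have Inth: "rev [0..<k] ! j = k - 1 - j" if "j < k" for j
    using that by (simp add: rev_nth)
  \<comment> \<open>With \<open>Q\<close> inverse to S, Y = QX is feasible exactly as X is, and M
    becomes diag(D, D).\<close>
  have reduce: "\<exists>Y. Y \<in> carrier_mat (2 * n) (2 * k) \<and> X = S * Y \<and> transpose_mat Y * J_mat n * Y = J_mat k \<and>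
      transpose_mat X * M * X = transpose_mat Y * diag2 n d * Y"
    if X: "X \<in> carrier_mat (2 * n) (2 * k)" "transpose_mat X * J_mat n * X = J_mat k" for X
  proof -
    obtain Q where Q: "Q \<in> carrier_mat (2 * n) (2 * n)" "S * Q = 1\<^sub>m (2 * n)"
      using symplectic_inverse[OF symS] by blast
    have Y: "Q * X \<in> carrier_mat (2 * n) (2 * k)" using Q(1) X(1) by (rule mult_carrier_mat)
    have XY: "X = S * (Q * X)"
      using assoc_mult_mat[OF S Q(1) X(1)] Q(2) left_mult_one_mat[OF X(1)] by simp
    have "transpose_mat (Q * X) * J_mat n * (Q * X) = transpose_mat X * J_mat n * X"
      using congruence_mult[OF S Y J_mat_carrier] by (simp only: SJ flip: XY)
    moreover have "transpose_mat X * M * X = transpose_mat (Q * X) * diag2 n d * (Q * X)"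
      using congruence_mult[OF S Y M] by (simp only: SM flip: XY)
    ultimately show ?thesis using X(2) Y XY by metis
  qed
  \<comment> \<open>The column pairs of Y are numbered backwards, so that pair j carries the weight
    \<open>\<mu> j\<close>.\<close>
  have bound: "2 * (\<Sum>j<k. d j * \<nu> (k - 1 - j)) \<le> mat_trace (diag2 k \<nu> * (transpose_mat Y * diag2 n d * Y))"
    and tight: "mat_trace (diag2 k \<nu> * (transpose_mat Y * diag2 n d * Y)) = 2 * (\<Sum>j<k. d j * \<nu> (k - 1 - j)) \<Longrightarrow>
      (\<forall>i<n. \<forall>j<k. antihol_part n k Y i (k - 1 - j) = 0) \<and>
      orthonormal_columns n k (\<lambda>i j. hol_part n k Y i (k - 1 - j)) \<and>
      eigen_columns n d k d (\<lambda>i j. hol_part n k Y i (k - 1 - j))"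
    if Y: "Y \<in> carrier_mat (2 * n) (2 * k)" "transpose_mat Y * J_mat n * Y = J_mat k" for Y
  proof -
    define u where "u i j = hol_part n k Y i (k - 1 - j)" for i j
    define v where "v i j = antihol_part n k Y i (k - 1 - j)" for i j
    have gram: "(\<Sum>i<n. cnj (u i a) * u i b) = (if a = b then 1 else 0) + (\<Sum>i<n. cnj (v i a) * v i b)"
      if ab: "a < k" "b < k" for a b
    proof -
      have "k - 1 - a = k - 1 - b \<longleftrightarrow> a = b" using ab by auto
      then show ?thesis
        using symplectic_gram[OF Y, of "k - 1 - a" "k - 1 - b"] ab by (simp add: u_def v_def)
    qed
    note bnd = weighted_trace_bound[of k n d \<mu> u v, OF assms(2) mono dpos \<mu>pos \<mu>dec gram]
    have tr: "mat_trace (diag2 k \<nu> * (transpose_mat Y * diag2 n d * Y))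
        = 2 * (\<Sum>j<k. \<mu> j * (\<Sum>i<n. d i * ((cmod (u i j))\<^sup>2 + (cmod (v i j))\<^sup>2)))"
      unfolding trace_eq_hol_antihol[OF Y(1)] rev_sum u_def v_def ..
    show "2 * (\<Sum>j<k. d j * \<nu> (k - 1 - j)) \<le> mat_trace (diag2 k \<nu> * (transpose_mat Y * diag2 n d * Y))"
      unfolding tr opt using bnd(1) by simp
    assume "mat_trace (diag2 k \<nu> * (transpose_mat Y * diag2 n d * Y)) = 2 * (\<Sum>j<k. d j * \<nu> (k - 1 - j))"
    then have eq: "(\<Sum>j<k. \<mu> j * (\<Sum>i<n. d i * ((cmod (u i j))\<^sup>2 + (cmod (v i j))\<^sup>2))) = (\<Sum>j<k. \<mu> j * d j)"
      unfolding tr opt by simp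
    have "(\<forall>i<n. \<forall>j<k. v i j = 0) \<and> orthonormal_columns n k u \<and> eigen_columns n d k d u"
      by (rule bnd(2)) (assumption | rule eq)+
    then show "(\<forall>i<n. \<forall>j<k. antihol_part n k Y i (k - 1 - j) = 0) \<and>
        orthonormal_columns n k (\<lambda>i j. hol_part n k Y i (k - 1 - j)) \<and>
        eigen_columns n d k d (\<lambda>i j. hol_part n k Y i (k - 1 - j))"
      unfolding u_def[symmetric] v_def[symmetric] .
  qed
  show ?thesis
  proof (intro conjI allI impI)
    \<comment> \<open>The pairs k-1, ..., 0 of S attain the value: the largest of the k eigenvalues
      meets the smallest weight.\<close>
    let ?X = "sel_cols n S (rev [0..<k])"
    have e: "d (rev [0..<k] ! j) = d (k - 1 - j)" if "j < k" for j
      by (simp only: Inth[OF that])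
    have X: "?X \<in> carrier_mat (2 * n) (2 * k)" "transpose_mat ?X * J_mat n * ?X = J_mat k"
      "transpose_mat ?X * M * ?X = diag2 k (\<lambda>j. d (k - 1 - j))"
      by (rule sel_cols_symplectic_eigen[OF W M I e], assumption)+
    have "mat_trace (diag2 k \<nu> * (transpose_mat ?X * M * ?X)) = (\<Sum>j<k. \<nu> j * (2 * d (k - 1 - j)))"
      unfolding X(3) mat_trace_diag2_mult[OF diag2_carrier] by (simp add: diag2_index)
    also have "\<dots> = (\<Sum>j<k. \<mu> j * (2 * d j))"
      unfolding rev_sum by (intro sum.cong) auto
    also have "\<dots> = 2 * (\<Sum>j<k. d j * \<nu> (k - 1 - j))"
      unfolding opt by (simp add: sum_distrib_left mult.left_commute)
    finally have tr: "mat_trace (diag2 k \<nu> * (transpose_mat ?X * M * ?X)) = 2 * (\<Sum>j<k. d j * \<nu> (k - 1 - j))" .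
    show "\<exists>X. X \<in> carrier_mat (2*n) (2*k) \<and> transpose_mat X * J_mat n * X = J_mat k \<and>
        mat_trace (diag2 k \<nu> * (transpose_mat X * M * X)) = 2 * (\<Sum>j<k. d j * \<nu> (k - 1 - j))"
      by (intro exI[of _ ?X] conjI X(1,2) tr)
  next
    fix X assume X: "X \<in> carrier_mat (2 * n) (2 * k)" "transpose_mat X * J_mat n * X = J_mat k"
    obtain Y where Y: "Y \<in> carrier_mat (2 * n) (2 * k)" "transpose_mat Y * J_mat n * Y = J_mat k"
      and XM: "transpose_mat X * M * X = transpose_mat Y * diag2 n d * Y"
      using reduce[OF X] by blast
    show "2 * (\<Sum>j<k. d j * \<nu> (k - 1 - j)) \<le> mat_trace (diag2 k \<nu> * (transpose_mat X * M * X))"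
      unfolding XM by (rule bound[OF Y])
  next
    fix X assume X: "X \<in> carrier_mat (2 * n) (2 * k)" "transpose_mat X * J_mat n * X = J_mat k"
      and eq: "mat_trace (diag2 k \<nu> * (transpose_mat X * M * X)) = 2 * (\<Sum>j<k. d j * \<nu> (k - 1 - j))"
    obtain Y where Y: "Y \<in> carrier_mat (2 * n) (2 * k)" "transpose_mat Y * J_mat n * Y = J_mat k"
      and XY: "X = S * Y" and XM: "transpose_mat X * M * X = transpose_mat Y * diag2 n d * Y"
      using reduce[OF X] by blast
    note t = tight[OF Y eq[unfolded XM]]
    \<comment> \<open>The columns from the minimizer are completed to a unitary eigenbasis
      \<open>w\<close>. Only the first k values of \<open>f\<close> are tied to d by index.\<close>
    obtain w f where w: "orthonormal_columns n n w" "eigen_columns n d n f w"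
      and wu: "\<And>i j. j < k \<Longrightarrow> w i j = hol_part n k Y i (k - 1 - j)" and fd: "\<And>j. j < k \<Longrightarrow> f j = d j"
      using extend_orthonormal_eigen_columns[OF conjunct1[OF conjunct2[OF t]] conjunct2[OF conjunct2[OF t]] assms(2)]
      by blast
    let ?S = "S * realification n w"
    have W': "williamson n M ?S f" by (rule williamson_realification[OF W M w])
    have Xsel: "X = sel_cols n ?S (rev [0..<k])"
      unfolding XY
    proof (rule hol_part_realification[OF Y(1) assms(2) _ _ S])
      fix i j assume ij: "i < n" "j < k"
      \<comment> \<open>Index reversal below k is an involution, which undoes the backward numbering
        of the pairs.\<close>
      then have rev: "k - 1 - (k - 1 - j) = j" "k - 1 - j < k" by auto
      have "antihol_part n k Y i (k - 1 - (k - 1 - j)) = 0" using conjunct1[OF t] ij(1) rev(2) by blast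
      then show "antihol_part n k Y i j = 0" unfolding rev(1) .
    next
      fix i j assume "j < k"
      then have "k - 1 - (k - 1 - j) = j" "k - 1 - j < k" by auto
      then show "w i (k - 1 - j) = hol_part n k Y i j" using wu[of "k - 1 - j" i] by simp
    qed
    have e: "f (rev [0..<k] ! j) = d (k - 1 - j)" if "j < k" for j
      using that by (simp add: Inth fd)
    show "sympl_eigvec_set n M k (\<lambda>j. d (k - 1 - j)) X"
      unfolding sympl_eigvec_set_def using W' I Xsel e by blast
    show "transpose_mat X * M * X = diag2 k (\<lambda>j. d (k - 1 - j))"
      unfolding Xsel by (rule sel_cols_symplectic_eigen(3)[OF W' M I e])
  qed
qed

end
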